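(* Let $(W,S)$ be a Coxeter system of rank $n$ whose associated bilinear form $B$ has signature $(n-1,1)$ and is irreducible. Let $W'$ be the special subgroup generated by a subset $S'\subset S$ with $n'=|S'|$, whose associated bilinear form $B'$ (the restriction of $B$) has signature $(n'-1,1)$ and is irreducible. If the normalized action of $W'$ is cocompact, then the limit set $\Lambda(W')$ is canonically embedded into $\Lambda(W)$; that is, there is a topological embedding $\iota:\Lambda(W')\to\Lambda(W)$ such that, whenever $\{w_k\}_k$ is a sequence in $W'$ whose orbit $w_k\cdot o'$ under the normalized action of $W'$ converges to $\xi\in\Lambda(W')$, the orbit $w_k\cdot o$ under the normalized action of $W$ converges to $\iota(\xi)$.
   Context: Coxeter data. $W$ is generated by $S=\{s_1,\dots,s_n\}$ subject only to the relations $(s_is_j)^{m_{ij}}=1$, with $m_{ii}=1$ and $m_{ij}=m_{ji}\in\mathbb{Z}_{>1}\cup\{\infty\}$ for $i\ne j$ (no relation if $m_{ij}=\infty$). $V$ is a real vector space with basis $\Delta=\{\alpha_1,\dots,\alpha_n\}$, orthonormal for the Euclidean inner product. The associated bilinear form $B$ is a symmetric bilinear form with $B(\alpha_i,\alpha_j)=-\cos(\pi/m_{ij})$ if $m_{ij}<\infty$ and $B(\alpha_i,\alpha_j)$ a chosen real number $\le -1$ if $m_{ij}=\infty$. $W$ acts linearly on $V$, $s_i$ acting by $s_i(v)=v-2B(\alpha_i,v)\alpha_i$. Signature $(p,q)$ means $p$ positive and $q$ negative eigenvalues of the Gram matrix. $B$ is irreducible if this matrix is not block-diagonal up to permutation of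 the basis. Normalized action. Let $o=\sum_i o_i\alpha_i$ be the eigenvector of $B$ for its negative eigenvalue with Euclidean norm $1$ and all $o_i>0$. For $v=\sum v_i\alpha_i$ put $|v|_1=\sum_i o_iv_i$, $V_1=\{v: |v|_1=1\}$, and $\widehat v=v/|v|_1$ when $|v|_1\neq 0$. The normalized action is $w\cdot v=\widehat{w(v)}$. Put $D=\{v\in V_1: B(v,v)<0\}$, with boundary $\partial D=\{v\in V_1: B(v,v)=0\}$ in $V_1$; both are preserved by the normalized action. The limit set $\Lambda(W)\subset\partial D$ is the set of accumulation points (in the Euclidean topology of $V_1$) of the orbit $W\cdot o$, with the subspace topology. The normalized action of $W$ is called cocompact if $D\cup\partial D\subset \mathrm{int}(\mathrm{conv}(\widehat\Delta))$, where $\widehat\Delta=\{\widehat\alpha:\alpha\in\Delta\}$ and the interior is taken in $V_1$. For the special subgroup $W'$, all these notions (normalized eigenvector $o'$, normalized action, limit set $\Lambda(W')$, cocompactness) are defined in the same way from the Coxeter system $(W',S')$, the basis $\Delta'=\{\alpha_s:s\in S'\}$, the space $V'=\mathrm{span}(\Delta')$ and the form $B'=B|_{V'\times V'}$. *)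

theory Defs
  imports
    "HOL-Analysis.Analysis"
    "HOL-Algebra.Generated_Groups"
    "HOL-Library.Extended_Nat"
begin

section \<open>Coxeter groups\<close>

text \<open>The generators are indexed by a finite type \<open>'n\<close>, so the rank is \<open>CARD('n)\<close>.\<close>

definition coxeter_matrix :: "('n \<Rightarrow> 'n \<Rightarrow> enat) \<Rightarrow> bool" where
  "coxeter_matrix m \<longleftrightarrow>
     (\<forall>i. m i i = 1) \<and> (\<forall>i j. m i j = m j i) \<and> (\<forall>i j. i \<noteq> j \<longrightarrow> 2 \<le> m i j)"

text \<open>
  The Coxeter group is the quotient of the monoid of words in the generators by the congruence
  generated by the relations. No formal inverses are needed, since
  \<open>m i i = 1\<close> makes every generator an involution.
\<close>

inductive word_eq :: "('n \<Rightarrow> 'n \<Rightarrow> enat) \<Rightarrow> 'n list \<Rightarrow> 'n list \<Rightarrow> bool"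
  for m :: "'n \<Rightarrow> 'n \<Rightarrow> enat" where
  relation: "m i j = enat k \<Longrightarrow> word_eq m (u @ concat (replicate k [i, j]) @ v) (u @ v)"
| refl: "word_eq m u u"
| sym: "word_eq m u v \<Longrightarrow> word_eq m v u"
| trans: "word_eq m u v \<Longrightarrow> word_eq m v w \<Longrightarrow> word_eq m u w"

definition word_class :: "('n \<Rightarrow> 'n \<Rightarrow> enat) \<Rightarrow> 'n list \<Rightarrow> 'n list set" where
  "word_class m u = {v. word_eq m u v}"

definition coxeter_group :: "('n \<Rightarrow> 'n \<Rightarrow> enat) \<Rightarrow> 'n list set monoid" where
  "coxeter_group m =
     \<lparr>carrier = range (word_class m),
      mult = (\<lambda>X Y. \<Union>x\<in>X. \<Union>y\<in>Y. word_class m (x @ y)),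
      one = word_class m []\<rparr>"

definition special_subgroup :: "('n \<Rightarrow> 'n \<Rightarrow> enat) \<Rightarrow> 'n set \<Rightarrow> 'n list set set" where
  "special_subgroup m I = generate (coxeter_group m) ((\<lambda>i. word_class m [i]) ` I)"


section \<open>The bilinear form\<close>

abbreviation simple_root :: "'n::finite \<Rightarrow> real ^ 'n" where
  "simple_root i \<equiv> axis i 1"

definition associated_form ::
    "('n::finite \<Rightarrow> 'n \<Rightarrow> enat) \<Rightarrow> (real ^ 'n \<Rightarrow> real ^ 'n \<Rightarrow> real) \<Rightarrow> bool" where
  "associated_form m B \<longleftrightarrow>
     bilinear B \<and> (\<forall>x y. B x y = B y x) \<and>
     (\<forall>i j. case m i j of
        enat k \<Rightarrow> B (simple_root i) (simple_root j) = - cos (pi / real k)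
      | \<infinity> \<Rightarrow> B (simple_root i) (simple_root j) \<le> - 1)"

text \<open>
  From here on, \<open>I\<close> is a set of indices and each notion refers to the restriction of \<open>B\<close> to
  the span of the simple roots indexed by \<open>I\<close>. For the full space take \<open>I = UNIV\<close>.
\<close>

definition root_span :: "'n set \<Rightarrow> (real ^ 'n::finite) set" where
  "root_span I = span (simple_root ` I)"

text \<open>Eigenspaces of the Gram matrix of the restricted form.\<close>

definition eigenspace ::
    "(real ^ 'n \<Rightarrow> real ^ 'n \<Rightarrow> real) \<Rightarrow> 'n set \<Rightarrow> real \<Rightarrow> (real ^ 'n::finite) set" where
  "eigenspace B I l =
     {v \<in> root_span I.
        \<forall>i\<in>I. (\<Sum>j\<in>I. B (simple_root i) (simple_root j) * v $ j) = l * v $ i}"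

text \<open>
  The numbers of positive and of negative eigenvalues, with multiplicity. The Gram matrix is
  real symmetric, so geometric and algebraic multiplicities agree.
\<close>

definition signature ::
    "(real ^ 'n \<Rightarrow> real ^ 'n \<Rightarrow> real) \<Rightarrow> 'n::finite set \<Rightarrow> nat \<times> nat" where
  "signature B I =
     ((\<Sum>l | 0 < l \<and> eigenspace B I l \<noteq> {0}. dim (eigenspace B I l)),
      (\<Sum>l | l < 0 \<and> eigenspace B I l \<noteq> {0}. dim (eigenspace B I l)))"

definition irreducible_form ::
    "(real ^ 'n \<Rightarrow> real ^ 'n \<Rightarrow> real) \<Rightarrow> 'n::finite set \<Rightarrow> bool" where
  "irreducible_form B I \<longleftrightarrow>
     \<not> (\<exists>J K. J \<noteq> {} \<and> K \<noteq> {} \<and> J \<inter> K = {} \<and> J \<union> K = I \<and>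
          (\<forall>j\<in>J. \<forall>k\<in>K. B (simple_root j) (simple_root k) = 0))"


section \<open>Linear and normalized action\<close>

definition reflection ::
    "(real ^ 'n \<Rightarrow> real ^ 'n \<Rightarrow> real) \<Rightarrow> 'n::finite \<Rightarrow> real ^ 'n \<Rightarrow> real ^ 'n" where
  "reflection B i v = v - (2 * B (simple_root i) v) *\<^sub>R simple_root i"

text \<open>
  A group element is a class of words, and all words of the class act by the same product of
  reflections. On \<open>root_span I\<close> the reflections with index in \<open>I\<close> are those of the restricted
  form, so the special subgroup of \<open>I\<close> acts on \<open>root_span I\<close> by the same formula.
\<close>

definition group_action ::
    "(real ^ 'n \<Rightarrow> real ^ 'n \<Rightarrow> real) \<Rightarrow> 'n::finite list set \<Rightarrow> real ^ 'n \<Rightarrow> real ^ 'n" where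
  "group_action B w v = the_elem ((\<lambda>u. foldr (reflection B) u v) ` w)"

definition neg_eigenvector ::
    "(real ^ 'n \<Rightarrow> real ^ 'n \<Rightarrow> real) \<Rightarrow> 'n::finite set \<Rightarrow> real ^ 'n" where
  "neg_eigenvector B I =
     (THE v. (\<exists>l<0. v \<in> eigenspace B I l) \<and> norm v = 1 \<and> (\<forall>i\<in>I. 0 < v $ i))"

definition height ::
    "(real ^ 'n \<Rightarrow> real ^ 'n \<Rightarrow> real) \<Rightarrow> 'n::finite set \<Rightarrow> real ^ 'n \<Rightarrow> real" where
  "height B I v = (\<Sum>i\<in>I. neg_eigenvector B I $ i * v $ i)"

definition height_one ::
    "(real ^ 'n \<Rightarrow> real ^ 'n \<Rightarrow> real) \<Rightarrow> 'n set \<Rightarrow> (real ^ 'n::finite) set" where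
  "height_one B I = {v \<in> root_span I. height B I v = 1}"

text \<open>Meaningful only for vectors of nonzero height.\<close>

definition normalize_vec ::
    "(real ^ 'n \<Rightarrow> real ^ 'n \<Rightarrow> real) \<Rightarrow> 'n::finite set \<Rightarrow> real ^ 'n \<Rightarrow> real ^ 'n" where
  "normalize_vec B I v = v /\<^sub>R height B I v"

definition normalized_action ::
    "(real ^ 'n \<Rightarrow> real ^ 'n \<Rightarrow> real) \<Rightarrow> 'n::finite set \<Rightarrow> 'n list set \<Rightarrow> real ^ 'n \<Rightarrow> real ^ 'n" where
  "normalized_action B I w v = normalize_vec B I (group_action B w v)"

definition domain_D ::
    "(real ^ 'n \<Rightarrow> real ^ 'n \<Rightarrow> real) \<Rightarrow> 'n set \<Rightarrow> (real ^ 'n::finite) set" where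
  "domain_D B I = {v \<in> height_one B I. B v v < 0}"

definition boundary_D ::
    "(real ^ 'n \<Rightarrow> real ^ 'n \<Rightarrow> real) \<Rightarrow> 'n set \<Rightarrow> (real ^ 'n::finite) set" where
  "boundary_D B I = {v \<in> height_one B I. B v v = 0}"

definition cocompact_action ::
    "(real ^ 'n \<Rightarrow> real ^ 'n \<Rightarrow> real) \<Rightarrow> 'n::finite set \<Rightarrow> bool" where
  "cocompact_action B I \<longleftrightarrow>
     domain_D B I \<union> boundary_D B I \<subseteq>
       top_of_set (height_one B I) interior_of
         (convex hull ((\<lambda>i. normalize_vec B I (simple_root i)) ` I))"

text \<open>The limit set of a group \<open>H\<close> acting on \<open>root_span I\<close>.\<close>

definition limit_set ::
    "(real ^ 'n \<Rightarrow> real ^ 'n \<Rightarrow> real) \<Rightarrow> 'n set \<Rightarrow> 'n list set set \<Rightarrow> (real ^ 'n::finite) set" where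
  "limit_set B I H =
     top_of_set (height_one B I) derived_set_of
       ((\<lambda>w. normalized_action B I w (neg_eigenvector B I)) ` H)"

end

theory Submission
  imports Defs
begin

text \<open>
  Write \<open>e\<close> and \<open>e'\<close> for the negative eigenvectors of the full form and of the restricted form. Both
  are timelike vectors of the same Lorentzian space, on which the group acts by isometries, and the
  height of a vector is its Euclidean product with \<open>e\<close>, that is, up to a negative factor, its product
  with \<open>e\<close> under the form. The idea of the proof is that the orbits of \<open>e\<close> and of \<open>e'\<close> run towards the
  same points of the light cone, because the isometries keep the hyperbolic distance of \<open>e\<close> and \<open>e'\<close>
  fixed.

  In detail, let \<open>w k\<close> be a sequence of group elements such that the rescaled vectors \<open>w k e'\<close>
  converge to a limit point \<open>\<xi>\<close> of the special subgroup. If \<open>\<xi>\<close> is lightlike, the heights of \<open>w k e'\<close>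
  are unbounded. The product of \<open>w k e'\<close> and \<open>w k e\<close> is constant, and the difference of two vectors of
  height one is measured by a positive definite form, so an explicit inequality
  (\<open>timelike_direction_dist\<close>) forces \<open>w k e\<close> to have the same limiting direction as \<open>w k e'\<close>. Hence the
  map \<open>\<iota>\<close> merely rescales \<open>\<xi>\<close> to height one. It is an embedding because rescaling to height one for
  the special subgroup inverts it, and its values are limit points of the whole group because a
  lightlike vector is never equal to one of the timelike orbit points.

  That limit points are lightlike is the discreteness of the action
  (\<open>orbit_accumulates_on_cone\<close>), which is where the Coxeter relations enter: every group
  element that acts nontrivially maps some simple root to a nonpositive combination of simple roots
  (\<open>exists_negative_root\<close>). As all coordinates of \<open>e\<close> are positive, \<open>-e\<close> is an interior point of the
  fundamental chamber, and such an element moves \<open>e\<close> by at least a fixed amount. The existence and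
  uniqueness of \<open>e\<close> and \<open>e'\<close> is a Perron--Frobenius argument (\<open>perron_frobenius\<close>).
\<close>


section \<open>Words in the generators\<close>

lemma word_eq_append:
  assumes "word_eq m u v"
  shows "word_eq m (a @ u @ b) (a @ v @ b)"
  using assms
proof (induction rule: word_eq.induct)
  case (relation i j k u v)
  then show ?case
    using word_eq.relation[of m i j k "a @ u" "v @ b"] by simp
next
  case (refl u)
  show ?case by (rule word_eq.refl)
next
  case (sym u v)
  show ?case by (rule word_eq.sym[OF sym.IH])
next
  case (trans u v w)
  show ?case by (rule word_eq.trans[OF trans.IH])
qed

lemma word_eq_appendL: "word_eq m u v \<Longrightarrow> word_eq m (a @ u) (a @ v)"
  using word_eq_append[of m u v a "[]"] by simp

lemma word_eq_appendR: "word_eq m u v \<Longrightarrow> word_eq m (u @ b) (v @ b)"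
  using word_eq_append[of m u v "[]" b] by simp

lemma word_eq_append_both:
  "word_eq m u u' \<Longrightarrow> word_eq m v v' \<Longrightarrow> word_eq m (u @ v) (u' @ v')"
  by (rule word_eq.trans[OF word_eq_appendR word_eq_appendL])

text \<open>All relators have even length, so the parity of a word is an invariant of its group element.\<close>

lemma word_eq_parity:
  assumes "word_eq m u v"
  shows "even (length u) \<longleftrightarrow> even (length v)"
  using assms
proof (induction rule: word_eq.induct)
  case (relation i j k u v)
  have "length (concat (replicate k [i, j])) = 2 * k"
    by (induction k) auto
  then show ?case by simp
qed auto

lemma word_eq_cancel_square:
  assumes "coxeter_matrix m"
  shows "word_eq m (a @ [i, i] @ b) (a @ b)"
proof -
  have "m i i = enat 1"
    using assms by (simp add: coxeter_matrix_def one_enat_def)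
  then have "word_eq m (a @ concat (replicate 1 [i, i]) @ b) (a @ b)"
    by (rule word_eq.relation)
  then show ?thesis by simp
qed

lemma word_eq_rev_self:
  assumes "coxeter_matrix m"
  shows "word_eq m (rev u @ u) []"
proof (induction u)
  case Nil
  then show ?case by (simp add: word_eq.refl)
next
  case (Cons a u)
  have "word_eq m (rev u @ [a, a] @ u) (rev u @ u)"
    by (rule word_eq_cancel_square[OF assms])
  from word_eq.trans[OF this Cons.IH] show ?case by simp
qed

lemma word_eq_self_rev:
  assumes "coxeter_matrix m"
  shows "word_eq m (u @ rev u) []"
  using word_eq_rev_self[OF assms, of "rev u"] by simp

lemma word_class_eq_iff: "word_class m u = word_class m v \<longleftrightarrow> word_eq m u v"
proof
  assume "word_class m u = word_class m v"
  then have "v \<in> word_class m u" by (simp add: word_class_def word_eq.refl)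
  then show "word_eq m u v" by (simp add: word_class_def)
next
  assume "word_eq m u v"
  then have "word_eq m u w \<longleftrightarrow> word_eq m v w" for w
    using word_eq.trans[of m u v w] word_eq.trans[of m v u w] word_eq.sym[of m u v] by blast
  then show "word_class m u = word_class m v" by (simp add: word_class_def)
qed

lemma coxeter_group_mult:
  "word_class m u \<otimes>\<^bsub>coxeter_group m\<^esub> word_class m v = word_class m (u @ v)"
proof -
  have "word_class m (x @ y) = word_class m (u @ v)"
    if "x \<in> word_class m u" "y \<in> word_class m v" for x y
  proof -
    have "word_eq m u x" "word_eq m v y" using that by (simp_all add: word_class_def)
    then have "word_eq m (u @ v) (x @ y)" by (rule word_eq_append_both)
    then show ?thesis unfolding word_class_eq_iff by (rule word_eq.sym)
  qed
  moreover have "u \<in> word_class m u" "v \<in> word_class m v"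
    by (simp_all add: word_class_def word_eq.refl)
  ultimately have "(\<Union>x\<in>word_class m u. \<Union>y\<in>word_class m v. word_class m (x @ y)) =
      word_class m (u @ v)"
    by blast
  then show ?thesis
    by (simp add: coxeter_group_def)
qed

lemma group_coxeter_group:
  assumes "coxeter_matrix m"
  shows "group (coxeter_group m)"
proof (rule groupI)
  fix x y z
  assume "x \<in> carrier (coxeter_group m)" "y \<in> carrier (coxeter_group m)"
    "z \<in> carrier (coxeter_group m)"
  then obtain u v w where uvw: "x = word_class m u" "y = word_class m v" "z = word_class m w"
    by (auto simp: coxeter_group_def)
  show "x \<otimes>\<^bsub>coxeter_group m\<^esub> y \<in> carrier (coxeter_group m)"
    unfolding uvw coxeter_group_mult by (simp add: coxeter_group_def)
  show "x \<otimes>\<^bsub>coxeter_group m\<^esub> y \<otimes>\<^bsub>coxeter_group m\<^esub> z =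
        x \<otimes>\<^bsub>coxeter_group m\<^esub> (y \<otimes>\<^bsub>coxeter_group m\<^esub> z)"
    unfolding uvw coxeter_group_mult by simp
next
  fix x assume "x \<in> carrier (coxeter_group m)"
  then obtain u where u: "x = word_class m u"
    by (auto simp: coxeter_group_def)
  have one: "\<one>\<^bsub>coxeter_group m\<^esub> = word_class m []"
    by (simp add: coxeter_group_def)
  show "\<one>\<^bsub>coxeter_group m\<^esub> \<otimes>\<^bsub>coxeter_group m\<^esub> x = x"
    unfolding one u coxeter_group_mult by simp
  have "word_class m (rev u) \<otimes>\<^bsub>coxeter_group m\<^esub> x = \<one>\<^bsub>coxeter_group m\<^esub>"
    unfolding one u coxeter_group_mult word_class_eq_iff by (rule word_eq_rev_self[OF assms])
  moreover have "word_class m (rev u) \<in> carrier (coxeter_group m)"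
    by (simp add: coxeter_group_def)
  ultimately show "\<exists>y\<in>carrier (coxeter_group m). y \<otimes>\<^bsub>coxeter_group m\<^esub> x = \<one>\<^bsub>coxeter_group m\<^esub>"
    by blast
next
  show "\<one>\<^bsub>coxeter_group m\<^esub> \<in> carrier (coxeter_group m)"
    by (simp add: coxeter_group_def)
qed

lemma special_subgroup_subset:
  assumes "coxeter_matrix m"
  shows "special_subgroup m I \<subseteq> carrier (coxeter_group m)"
proof -
  have "(\<lambda>i. word_class m [i]) ` I \<subseteq> carrier (coxeter_group m)"
    by (auto simp: coxeter_group_def)
  then show ?thesis
    unfolding special_subgroup_def by (rule group.generate_incl[OF group_coxeter_group[OF assms]])
qed


section \<open>Alternating words and Chebyshev polynomials\<close>

text \<open>
  The recursion is at the front because words act from the left: the root computed for the shorter word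
  only has to be reflected once more.
\<close>

fun alt_word :: "nat \<Rightarrow> 'a \<Rightarrow> 'a \<Rightarrow> 'a list" where
  "alt_word 0 x y = []"
| "alt_word (Suc n) x y = x # alt_word n y x"

lemma length_alt_word [simp]: "length (alt_word n x y) = n"
  by (induction n arbitrary: x y) auto

lemma set_alt_word: "set (alt_word n x y) \<subseteq> {x, y}"
  by (induction n arbitrary: x y) fastforce+

lemma alt_word_add:
  "alt_word (a + b) x y = alt_word a x y @ (if even a then alt_word b x y else alt_word b y x)"
  by (induction a arbitrary: x y) auto

lemma alt_word_Suc_snoc:
  "alt_word (Suc n) x y = alt_word n x y @ [if even n then x else y]"
  using alt_word_add[of n 1 x y] by auto

lemma concat_replicate_pair: "concat (replicate k [x, y]) = alt_word (2 * k) x y"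
  by (induction k) auto

lemma alternating_word_two_letters:
  assumes "set u \<subseteq> {s, t}" "distinct_adj u" 
  shows "\<exists>x y. {x, y} = {s, t} \<and> u = alt_word (length u) x y"
  using assms
proof (induction u)
  case Nil
  then show ?case by auto
next
  case (Cons a u)
  then obtain x y where xy: "{x, y} = {s, t}" "u = alt_word (length u) x y"
    by (auto simp: distinct_adj_Cons)
  define b where "b = (if a = s then t else s)"
  have ab: "{a, b} = {s, t}" using Cons.prems(1) by (auto simp: b_def)
  have "u = alt_word (length u) b a"
  proof (cases u)
    case (Cons c u')
    then have "x = c" using xy(2) by simp
    moreover have "c \<noteq> a" using Cons.prems(2) Cons by (auto simp: distinct_adj_Cons)
    ultimately have "x = b \<and> y = a" using xy(1) ab by (auto simp: doubleton_eq_iff)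
    then show ?thesis using xy(2) by simp
  qed simp
  with ab have "{a, b} = {s, t} \<and> a # u = alt_word (length (a # u)) a b" by simp
  then show ?case by blast
qed

lemma not_distinct_adjE:
  assumes "\<not> distinct_adj u"
  obtains a b i where "u = a @ [i, i] @ b"
proof -
  have "\<exists>a b i. u = a @ [i, i] @ b"
    using assms
  proof (induction u)
    case (Cons c u)
    show ?case
    proof (cases "distinct_adj u")
      case True
      then obtain v where "u = c # v"
        using Cons.prems by (cases u) (auto simp: distinct_adj_Cons)
      then have "c # u = [] @ [c, c] @ v" by simp
      then show ?thesis by blast
    next
      case False
      then obtain a b i where "u = a @ [i, i] @ b" using Cons.IH by blast
      then have "c # u = (c # a) @ [i, i] @ b" by simp
      then show ?thesis by blast
    qed
  qed simp
  then show thesis using that by blast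
qed

text \<open>
  The Chebyshev polynomials of the second kind with shifted index: at \<open>c = cos t\<close> the value is
  \<open>sin (n t) / sin t\<close>. They are the coefficients of the roots of a dihedral group.
\<close>

fun cheb :: "real \<Rightarrow> nat \<Rightarrow> real" where
  "cheb c 0 = 0"
| "cheb c (Suc 0) = 1"
| "cheb c (Suc (Suc n)) = 2 * c * cheb c (Suc n) - cheb c n"

lemma cheb_cos: "cheb (cos t) n * sin t = sin (real n * t)"
proof (induction "cos t" n rule: cheb.induct)
  case (3 n)
  have "sin (real (Suc (Suc n)) * t) + sin (real n * t) = 2 * cos t * sin (real (Suc n) * t)"
  proof -
    have "real (Suc (Suc n)) * t = real (Suc n) * t + t" "real n * t = real (Suc n) * t - t"
      by (simp_all add: algebra_simps)
    then show ?thesis by (simp only: sin_add sin_diff) (simp add: algebra_simps)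
  qed
  with 3 show ?case by (simp add: left_diff_distrib mult.assoc)
qed auto

lemma cheb_nonneg_ge_1:
  assumes "1 \<le> c"
  shows "0 \<le> cheb c n"
proof -
  have "0 \<le> cheb c n \<and> cheb c n \<le> cheb c (Suc n)"
  proof (induction n)
    case (Suc n)
    then have "1 * cheb c (Suc n) \<le> c * cheb c (Suc n)"
      using assms by (intro mult_right_mono) auto
    with Suc show ?case by simp
  qed simp
  then show ?thesis by simp
qed

lemma cheb_nonneg_cos:
  assumes "2 \<le> k" "n \<le> k"
  shows "0 \<le> cheb (cos (pi / real k)) n"
proof -
  have s: "0 < sin (pi / real k)"
    using assms by (intro sin_gt_zero) (auto simp: divide_simps)
  have "real n * (pi / real k) \<le> pi"
    using assms by (simp add: divide_simps)
  then have "0 \<le> sin (real n * (pi / real k))"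
    by (intro sin_ge_zero) auto
  with s show ?thesis
    unfolding cheb_cos[symmetric] by (simp add: zero_le_mult_iff)
qed


section \<open>Symmetric forms and their eigenvectors\<close>

lemma mem_root_span:
  fixes v :: "real ^ 'n::finite"
  shows "v \<in> root_span I \<longleftrightarrow> (\<forall>i. i \<notin> I \<longrightarrow> v $ i = 0)"
proof -
  have "(simple_root ` I :: (real ^ 'n) set) \<subseteq> Basis"
    by (auto simp: Basis_vec_def)
  note span_substd_basis[OF this]
  moreover have "(\<forall>b\<in>Basis. b \<notin> simple_root ` I \<longrightarrow> v \<bullet> b = 0) \<longleftrightarrow> (\<forall>i. i \<notin> I \<longrightarrow> v $ i = 0)"
    by (auto simp: Basis_vec_def inner_axis axis_eq_axis)
  ultimately show ?thesis by (simp add: root_span_def)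
qed

lemma subspace_root_span: "subspace (root_span I)"
  by (simp add: root_span_def)

lemma simple_root_in_root_span: "i \<in> I \<Longrightarrow> simple_root i \<in> root_span I"
  by (simp add: root_span_def span_base)

lemma root_span_UNIV: "root_span UNIV = UNIV"
  by (auto simp: mem_root_span)

lemma root_span_expand:
  assumes "v \<in> root_span I"
  shows "v = (\<Sum>i\<in>I. v $ i *\<^sub>R simple_root i)"
  using assms
  by (auto simp: vec_eq_iff mem_root_span axis_def if_distrib[of "\<lambda>x. _ * x"] cong: if_cong)

lemma inner_root_span:
  assumes "v \<in> root_span I"
  shows "x \<bullet> v = (\<Sum>i\<in>I. v $ i * x $ i)"
  unfolding inner_vec_def inner_real_def
  using assms by (intro sum.mono_neutral_cong_right) (auto simp: mem_root_span)

locale symmetric_form =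
  fixes B :: "real ^ 'n::finite \<Rightarrow> real ^ 'n \<Rightarrow> real"
  assumes bilinear_B: "bilinear B" and B_sym: "B x y = B y x"
begin

lemmas B_linear =
  bilinear_ladd[OF bilinear_B] bilinear_radd[OF bilinear_B]
  bilinear_lsub[OF bilinear_B] bilinear_rsub[OF bilinear_B]
  bilinear_lmul[OF bilinear_B] bilinear_rmul[OF bilinear_B]
  bilinear_lneg[OF bilinear_B] bilinear_rneg[OF bilinear_B]
  bilinear_lzero[OF bilinear_B] bilinear_rzero[OF bilinear_B]

lemma bounded_bilinear_B: "bounded_bilinear B"
  using bilinear_B bilinear_conv_bounded_bilinear by blast

lemmas tendsto_B = bounded_bilinear.tendsto[OF bounded_bilinear_B]

lemma B_bound:
  obtains K where "0 < K" "\<And>x y. \<bar>B x y\<bar> \<le> K * norm x * norm y"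
proof -
  obtain K where "0 < K" "\<And>x y. norm (B x y) \<le> norm x * norm y * K"
    using bounded_bilinear.pos_bounded[OF bounded_bilinear_B] by blast
  then show thesis using that[of K] by (simp add: mult_ac)
qed

lemma B_expand_right:
  assumes "v \<in> root_span I"
  shows "B x v = (\<Sum>i\<in>I. B x (simple_root i) * v $ i)"
proof -
  have "linear (B x)" using bilinear_B by (simp add: bilinear_def)
  then have "B x (\<Sum>i\<in>I. v $ i *\<^sub>R simple_root i) = (\<Sum>i\<in>I. v $ i * B x (simple_root i))"
    by (simp add: linear_sum B_linear)
  then show ?thesis using root_span_expand[OF assms] by (simp add: mult.commute)
qed

lemma eigenspace_iff:
  "v \<in> eigenspace B I l \<longleftrightarrow> v \<in> root_span I \<and> (\<forall>x\<in>root_span I. B x v = l * (x \<bullet> v))"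
proof (cases "v \<in> root_span I")
  case True
  have "(\<forall>i\<in>I. (\<Sum>j\<in>I. B (simple_root i) (simple_root j) * v $ j) = l * v $ i) \<longleftrightarrow>
        (\<forall>x\<in>root_span I. B x v = l * (x \<bullet> v))"
    unfolding B_expand_right[OF True, symmetric]
  proof
    assume *: "\<forall>i\<in>I. B (simple_root i) v = l * v $ i"
    show "\<forall>x\<in>root_span I. B x v = l * (x \<bullet> v)"
    proof
      fix x assume x: "x \<in> root_span I"
      have "B x v = (\<Sum>i\<in>I. B v (simple_root i) * x $ i)"
        using B_expand_right[OF x, of v] B_sym by simp
      also have "\<dots> = (\<Sum>i\<in>I. l * (x $ i * v $ i))"
        using * B_sym[of v] by (intro sum.cong) auto
      also have "\<dots> = l * (x \<bullet> v)"
        using inner_root_span[OF x, of v] by (simp add: sum_distrib_left inner_commute)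
      finally show "B x v = l * (x \<bullet> v)" .
    qed
  next
    assume "\<forall>x\<in>root_span I. B x v = l * (x \<bullet> v)"
    then show "\<forall>i\<in>I. B (simple_root i) v = l * v $ i"
      using simple_root_in_root_span[where I = I] by (simp add: inner_axis')
  qed
  then show ?thesis using True by (simp add: eigenspace_def)
qed (simp add: eigenspace_def)

lemma subspace_eigenspace: "subspace (eigenspace B I l)"
proof (rule subspaceI)
  show "0 \<in> eigenspace B I l"
    by (simp add: eigenspace_iff subspace_0[OF subspace_root_span] B_linear)
next
  fix x y assume "x \<in> eigenspace B I l" "y \<in> eigenspace B I l"
  then show "x + y \<in> eigenspace B I l"
    by (simp add: eigenspace_iff subspace_add[OF subspace_root_span] B_linear inner_add_right
        distrib_left)
next
  fix c x assume "x \<in> eigenspace B I l"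
  then show "c *\<^sub>R x \<in> eigenspace B I l"
    by (simp add: eigenspace_iff subspace_scale[OF subspace_root_span] B_linear)
qed

lemma eigenspaces_orthogonal:
  assumes "v \<in> eigenspace B I k" "w \<in> eigenspace B I l" "k \<noteq> l"
  shows "v \<bullet> w = 0"
proof -
  have "k * (w \<bullet> v) = B w v" "l * (v \<bullet> w) = B v w"
    using assms by (auto simp: eigenspace_iff)
  then have "(k - l) * (v \<bullet> w) = 0"
    using B_sym[of v w] by (simp add: inner_commute left_diff_distrib)
  then show ?thesis using assms(3) by simp
qed

lemma sum_dim_eigenspaces_le:
  assumes "finite L"
  shows "(\<Sum>l\<in>L. dim (eigenspace B I l)) \<le> CARD('n)"
proof -
  have "dim (\<Union>l\<in>L. eigenspace B I l) = (\<Sum>l\<in>L. dim (eigenspace B I l))"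
    using assms
  proof (induction L rule: finite_induct)
    case (insert k L)
    have "dim (eigenspace B I k \<union> (\<Union>l\<in>L. eigenspace B I l)) =
        dim (eigenspace B I k) + dim (\<Union>l\<in>L. eigenspace B I l)"
      by (rule dim_orthogonal_sum) (use insert.hyps eigenspaces_orthogonal in blast)
    with insert show ?case by simp
  qed simp
  then show ?thesis using dim_subset_UNIV[of "\<Union>l\<in>L. eigenspace B I l"] by simp
qed

lemma eigenspace_dim_ge:
  assumes "v \<in> eigenspace B I l" "v \<noteq> 0"
  shows "1 \<le> dim (eigenspace B I l)"
proof -
  have "dim (eigenspace B I l) \<noteq> 0" unfolding dim_eq_0 using assms by blast
  then show ?thesis by linarith
qed

lemma eigenspace_dim_ge_2:
  assumes "v \<in> eigenspace B I l" "w \<in> eigenspace B I l" "v \<noteq> 0" "w \<noteq> 0" "v \<bullet> w = 0"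
  shows "2 \<le> dim (eigenspace B I l)"
proof -
  have "v \<noteq> w" using assms by auto
  have "independent {v, w}"
    using assms by (intro pairwise_orthogonal_independent)
      (auto simp: pairwise_def orthogonal_def inner_commute)
  then have "card {v, w} \<le> dim (eigenspace B I l)"
    using assms by (intro independent_card_le_dim) auto
  then show ?thesis using \<open>v \<noteq> w\<close> by simp
qed

text \<open>
  Along the line \<open>v + t *\<^sub>R u\<close>, minimality makes \<open>2 * t * a + t\<^sup>2 * b\<close> nonnegative for all \<open>t\<close>, where \<open>a\<close>
  is the defect of the eigenvector equation; hence \<open>a = 0\<close>.
\<close>

lemma minimizer_is_eigenvector:
  assumes U: "subspace U" "v \<in> U" "norm v = 1" "u \<in> U"
    and min: "\<And>u. u \<in> U \<Longrightarrow> B v v * (u \<bullet> u) \<le> B u u"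
  shows "B u v = B v v * (u \<bullet> v)"
proof -
  define a b where "a = B u v - B v v * (u \<bullet> v)" and "b = B u u - B v v * (u \<bullet> u)"
  have vv: "v \<bullet> v = 1" using U(3) by (simp add: dot_square_norm)
  have b: "0 \<le> b" unfolding b_def using min[OF U(4)] by simp
  have "0 \<le> 2 * t * a + t\<^sup>2 * b" for t
  proof -
    have "v + t *\<^sub>R u \<in> U" using U by (simp add: subspace_add subspace_scale)
    from min[OF this] show ?thesis
      by (simp add: a_def b_def B_linear inner_simps vv B_sym[of v u] inner_commute[of v u]
          power2_eq_square algebra_simps)
  qed
  \<comment> \<open>The parabola has its minimum at \<open>- a / b\<close>; the denominator \<open>b + 1\<close> covers \<open>b = 0\<close> as well.\<close>
  from this[of "- a / (b + 1)"] have "0 \<le> 2 * (- a / (b + 1)) * a + (- a / (b + 1))\<^sup>2 * b" .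
  also have "\<dots> = - (a\<^sup>2 * (b + 2)) / (b + 1)\<^sup>2"
    using b by (simp add: divide_simps power2_eq_square) (simp add: algebra_simps)
  finally have "a\<^sup>2 * (b + 2) \<le> 0"
    using b by (simp add: divide_le_0_iff zero_le_divide_iff)
  then have "a\<^sup>2 \<le> 0" using b by (simp add: mult_le_0_iff)
  then show ?thesis by (simp add: a_def)
qed

lemma exists_minimizer:
  assumes "subspace U" "u \<in> U" "u \<noteq> 0"
  obtains v where "v \<in> U" "norm v = 1" "\<And>u. u \<in> U \<Longrightarrow> B v v * (u \<bullet> u) \<le> B u u"
proof -
  let ?S = "U \<inter> sphere 0 1"
  have "compact ?S" using closed_subspace[OF assms(1)] by (simp add: closed_Int_compact)
  moreover have "(1 / norm u) *\<^sub>R u \<in> ?S" using assms by (simp add: subspace_scale)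
  moreover have "continuous_on ?S (\<lambda>x. B x x)"
    by (intro bounded_bilinear.continuous_on[OF bounded_bilinear_B] continuous_on_id)
  ultimately obtain v where v: "v \<in> ?S" "\<And>x. x \<in> ?S \<Longrightarrow> B v v \<le> B x x"
    using continuous_attains_inf[of ?S "\<lambda>x. B x x"] by blast
  have "B v v * (x \<bullet> x) \<le> B x x" if "x \<in> U" for x
  proof (cases "x = 0")
    case False
    have "(1 / norm x) *\<^sub>R x \<in> ?S" using False that assms(1) by (simp add: subspace_scale)
    from v(2)[OF this] show ?thesis
      using False by (simp add: B_linear dot_square_norm field_simps power2_eq_square)
  qed (simp add: B_linear)
  with v(1) show thesis by (intro that[of v]) auto
qed

text \<open>
  The Perron--Frobenius argument. If \<open>v\<close> minimizes the form on the unit sphere, then so does the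
  vector of the absolute values of its coordinates, because all off-diagonal entries are
  nonpositive. A vanishing coordinate of the latter would split the Gram matrix into two blocks.
  Two eigenvectors with positive coordinates cannot be orthogonal, so they belong to the same
  eigenvalue, and uniqueness follows because the negative eigenvalue has multiplicity one.
\<close>

lemma perron_frobenius:
  fixes I :: "'n set"
  assumes off_diag: "\<And>i j. i \<noteq> j \<Longrightarrow> B (simple_root i) (simple_root j) \<le> 0"
    and irr: "irreducible_form B I"
    and sgn: "snd (signature B I) = 1"
  obtains l where "l < 0" "neg_eigenvector B I \<in> eigenspace B I l" "norm (neg_eigenvector B I) = 1"
    "\<And>i. i \<in> I \<Longrightarrow> 0 < neg_eigenvector B I $ i"
proof -
  define N where "N = {l. l < 0 \<and> eigenspace B I l \<noteq> {0}}"
  have sumN: "(\<Sum>l\<in>N. dim (eigenspace B I l)) = 1"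
    using sgn by (simp add: signature_def N_def)
  have finN: "finite N" using sumN by (auto intro: ccontr)
  have "N \<noteq> {}" using sumN by auto
  then obtain k where k: "k \<in> N" by auto
  have "0 \<in> eigenspace B I k" using subspace_eigenspace subspace_0 by blast
  then obtain x where x: "x \<in> eigenspace B I k" "x \<noteq> 0" and k0: "k < 0"
    using k unfolding N_def by blast
  have xs: "x \<in> root_span I" and Bx: "B x x = k * (x \<bullet> x)" using x(1) by (auto simp: eigenspace_iff)
  obtain v where v: "v \<in> root_span I" "norm v = 1"
    and min: "\<And>u. u \<in> root_span I \<Longrightarrow> B v v * (u \<bullet> u) \<le> B u u"
    using exists_minimizer[OF subspace_root_span xs x(2)] by blast
  have "B v v * (x \<bullet> x) \<le> k * (x \<bullet> x)" using min[OF xs] Bx by simp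
  moreover have "0 < x \<bullet> x" using x(2) by simp
  ultimately have "B v v \<le> k" by (rule mult_right_le_imp_le)
  then have vneg: "B v v < 0" using k0 by simp
  define w where "w = (\<chi> i. \<bar>v $ i\<bar>)"
  have ws: "w \<in> root_span I" using v(1) by (simp add: w_def mem_root_span)
  have wnorm: "norm w = 1" using v(2) by (simp add: w_def norm_vec_def L2_set_def)
  then have ww: "w \<bullet> w = 1" by (simp add: dot_square_norm)
  have "B w w \<le> B v v"
  proof -
    have Bxx: "B y y = (\<Sum>i\<in>I. \<Sum>j\<in>I. B (simple_root i) (simple_root j) * (y $ i * y $ j))"
      if y: "y \<in> root_span I" for y
    proof -
      have "B y y = (\<Sum>i\<in>I. B y (simple_root i) * y $ i)" by (rule B_expand_right[OF y])
      also have "\<dots> = (\<Sum>i\<in>I. (\<Sum>j\<in>I. B (simple_root i) (simple_root j) * y $ j) * y $ i)"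
      proof -
        have "B y (simple_root i) = (\<Sum>j\<in>I. B (simple_root i) (simple_root j) * y $ j)" for i
          using B_expand_right[OF y, of "simple_root i"] B_sym[of y] by simp
        then show ?thesis by simp
      qed
      finally show ?thesis by (simp add: sum_distrib_left sum_distrib_right mult_ac)
    qed
    show ?thesis
      unfolding Bxx[OF ws] Bxx[OF v(1)]
    proof (intro sum_mono)
      fix i j
      show "B (simple_root i) (simple_root j) * (w $ i * w $ j)
          \<le> B (simple_root i) (simple_root j) * (v $ i * v $ j)"
      proof (cases "i = j")
        case False
        have "v $ i * v $ j \<le> w $ i * w $ j"
          by (simp add: w_def abs_mult[symmetric])
        then show ?thesis using off_diag[OF False] by (rule mult_left_mono_neg)
      qed (simp add: w_def)
    qed
  qed
  then have Bww: "B w w = B v v" using min[OF ws] ww by simp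
  define l where "l = B v v"
  have w_eig: "w \<in> eigenspace B I l"
    unfolding eigenspace_iff l_def
    using minimizer_is_eigenvector[OF subspace_root_span ws wnorm] min ws Bww by simp
  have w_nonneg: "0 \<le> w $ i" for i by (simp add: w_def)
  have w_pos: "0 < w $ i" if "i \<in> I" for i
  proof (rule ccontr)
    assume "\<not> 0 < w $ i"
    then have wi: "w $ i = 0" using w_nonneg[of i] by simp
    define J where "J = {j \<in> I. w $ j = 0}"
    define K where "K = {j \<in> I. 0 < w $ j}"
    have "K \<noteq> {}"
    proof
      assume "K = {}"
      then have "w $ j \<le> 0" for j
        using ws by (cases "j \<in> I") (auto simp: K_def mem_root_span not_less)
      then have "w = 0" using w_nonneg by (simp add: vec_eq_iff order_antisym)
      then show False using wnorm by simp
    qed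
    moreover have "J \<noteq> {}" using that wi unfolding J_def by blast
    moreover have "J \<inter> K = {}" "J \<union> K = I" using w_nonneg by (auto simp: J_def K_def le_less)
    moreover have "B (simple_root j) (simple_root k) = 0" if j: "j \<in> J" and k: "k \<in> K" for j k
    proof -
      have wj: "w $ j = 0" "j \<in> I" using j by (auto simp: J_def)
      have terms: "0 \<le> - (B (simple_root j) (simple_root i) * w $ i)" for i
        using off_diag[of j i] w_nonneg[of i] wj by (cases "i = j") (auto simp: mult_le_0_iff)
      have "B (simple_root j) w = l * w $ j"
        using w_eig simple_root_in_root_span[OF wj(2)] by (simp add: eigenspace_iff inner_axis')
      then have "(\<Sum>i\<in>I. - (B (simple_root j) (simple_root i) * w $ i)) = 0"
        using B_expand_right[OF ws] wj by (simp add: sum_negf)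
      then have "\<forall>i\<in>I. - (B (simple_root j) (simple_root i) * w $ i) = 0"
        using terms by (subst (asm) sum_nonneg_eq_0_iff) auto
      then show ?thesis using k by (auto simp: K_def)
    qed
    ultimately have "J \<noteq> {} \<and> K \<noteq> {} \<and> J \<inter> K = {} \<and> J \<union> K = I \<and>
        (\<forall>j\<in>J. \<forall>k\<in>K. B (simple_root j) (simple_root k) = 0)"
      by (intro conjI ballI) assumption+
    then have "\<not> irreducible_form B I" unfolding irreducible_form_def not_not by (intro exI)
    then show False using irr by contradiction
  qed
  have l0: "l < 0" using vneg by (simp add: l_def)
  have w0: "w \<noteq> 0" using wnorm by auto
  have lN: "l \<in> N" using l0 w_eig w0 unfolding N_def by blast
  have diml: "dim (eigenspace B I l) \<le> 1"
    using member_le_sum[OF lN, of "\<lambda>l. dim (eigenspace B I l)"] finN sumN by simp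
  have "neg_eigenvector B I = w"
    unfolding neg_eigenvector_def
  proof (rule the_equality)
    show "(\<exists>l<0. w \<in> eigenspace B I l) \<and> norm w = 1 \<and> (\<forall>i\<in>I. 0 < w $ i)"
      using l0 w_eig wnorm w_pos by (intro conjI ballI exI[of _ l]) auto
  next
    fix y assume y: "(\<exists>l<0. y \<in> eigenspace B I l) \<and> norm y = 1 \<and> (\<forall>i\<in>I. 0 < y $ i)"
    then obtain l' where l': "y \<in> eigenspace B I l'" by blast
    have ys: "y \<in> root_span I" using l' by (simp add: eigenspace_iff)
    have "I \<noteq> {}" using w0 ws by (auto simp: mem_root_span vec_eq_iff)
    then have "0 < w \<bullet> y"
      unfolding inner_root_span[OF ys] using y w_pos by (intro sum_pos) auto
    then have "l' = l" using eigenspaces_orthogonal[OF w_eig l'] by (cases "l = l'") auto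
    define z where "z = y - (w \<bullet> y) *\<^sub>R w"
    have "z \<in> eigenspace B I l"
      unfolding z_def using l' \<open>l' = l\<close> w_eig subspace_eigenspace
      by (simp add: subspace_diff subspace_scale)
    moreover have "w \<bullet> z = 0" by (simp add: z_def inner_simps ww)
    ultimately have "z = 0"
      using eigenspace_dim_ge_2[of w I l z] w_eig w0 diml by (cases "z = 0") auto
    then have yw: "y = (w \<bullet> y) *\<^sub>R w" by (simp add: z_def)
    then have "norm y = \<bar>w \<bullet> y\<bar> * norm w" by (metis norm_scaleR)
    then have "w \<bullet> y = 1" using y wnorm \<open>0 < w \<bullet> y\<close> by simp
    with yw show "y = w" by (metis scaleR_one)
  qed
  then show thesis using that[of l] l0 w_eig wnorm w_pos by simp
qed

text \<open>
  A minimizer of the form on the unit sphere of the complement of \<open>e\<close> is a second eigenvector. A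
  negative eigenvalue would raise the number of negative eigenvalues to two, and the eigenvalue \<open>0\<close>
  would make the total multiplicity exceed the dimension.
\<close>

lemma positive_on_complement:
  assumes e: "e \<in> eigenspace B UNIV l" "norm e = 1" "l < 0"
    and sgn: "signature B UNIV = (CARD('n) - 1, 1)"
  obtains \<mu> where "0 < \<mu>" "\<And>u. u \<bullet> e = 0 \<Longrightarrow> \<mu> * (u \<bullet> u) \<le> B u u"
proof (cases "\<exists>u. u \<bullet> e = 0 \<and> u \<noteq> 0")
  case False
  then have "1 * (u \<bullet> u) \<le> B u u" if "u \<bullet> e = 0" for u
    using that by (cases "u = 0") (auto simp: B_linear)
  then show thesis using that[of 1] by simp
next
  case True
  define U where "U = {u. u \<bullet> e = 0}"
  have U: "subspace U" unfolding U_def by (auto simp: subspace_def inner_simps)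
  obtain v where v: "v \<in> U" "norm v = 1" and min: "\<And>u. u \<in> U \<Longrightarrow> B v v * (u \<bullet> u) \<le> B u u"
    using exists_minimizer[OF U] True unfolding U_def by blast
  define \<mu> where "\<mu> = B v v"
  have ee: "e \<bullet> e = 1" using e(2) by (simp add: dot_square_norm)
  have e0: "e \<noteq> 0" "v \<noteq> 0" using e v by auto
  have ve: "v \<bullet> e = 0" using v by (simp add: U_def)
  have v_eig: "v \<in> eigenspace B UNIV \<mu>"
    unfolding eigenspace_iff root_span_UNIV
  proof (intro conjI ballI UNIV_I)
    fix x
    define u where "u = x - (x \<bullet> e) *\<^sub>R e"
    have "u \<in> U" by (simp add: U_def u_def inner_simps ee)
    then have "B u v = \<mu> * (u \<bullet> v)"
      unfolding \<mu>_def using minimizer_is_eigenvector[OF U v] min by blast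
    moreover have "B e v = 0"
      using e(1) ve B_sym[of e v] by (simp add: eigenspace_iff root_span_UNIV)
    ultimately show "B x v = \<mu> * (x \<bullet> v)"
      using ve by (simp add: u_def B_linear inner_simps inner_commute)
  qed
  define P where "P = {l. 0 < l \<and> eigenspace B UNIV l \<noteq> {0}}"
  define N where "N = {l. l < 0 \<and> eigenspace B UNIV l \<noteq> {0}}"
  let ?d = "\<lambda>l. dim (eigenspace B UNIV l)"
  have sumP: "sum ?d P = CARD('n) - 1" and sumN: "sum ?d N = 1"
    using sgn by (simp_all add: signature_def P_def N_def)
  have finN: "finite N" using sumN by (auto intro: ccontr)
  have lN: "l \<in> N" using e e0 unfolding N_def by blast
  have "\<not> \<mu> < 0"
  proof
    assume "\<mu> < 0"
    then have \<mu>N: "\<mu> \<in> N" using v_eig e0 unfolding N_def by blast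
    show False
    proof (cases "\<mu> = l")
      case True
      then have "2 \<le> ?d l" using eigenspace_dim_ge_2[OF _ e(1)] v_eig e0 ve by blast
      then show False using member_le_sum[OF lN, of ?d] finN sumN by simp
    next
      case False
      have "sum ?d {\<mu>, l} \<le> sum ?d N"
        using \<mu>N lN finN by (intro sum_mono2) auto
      moreover have "1 \<le> ?d \<mu>" "1 \<le> ?d l" using eigenspace_dim_ge v_eig e(1) e0 by blast+
      ultimately show False using False sumN by simp
    qed
  qed
  moreover have "\<mu> \<noteq> 0"
  proof
    assume "\<mu> = 0"
    \<comment> \<open>If \<open>P\<close> were infinite, its sum would be the default value \<open>0\<close>, as for the empty set.\<close>
    define P' where "P' = (if finite P then P else {})"
    have P': "finite P'" "P' \<subseteq> P" "sum ?d P' = CARD('n) - 1"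
      using sumP by (auto simp: P'_def)
    have "P' \<inter> insert 0 N = {}" "0 \<notin> N" using P'(2) by (auto simp: P_def N_def)
    then have "sum ?d (P' \<union> insert 0 N) = (CARD('n) - 1) + (?d 0 + 1)"
      using P' finN sumN by (simp add: sum.union_disjoint)
    moreover have "sum ?d (P' \<union> insert 0 N) \<le> CARD('n)"
      using P' finN by (intro sum_dim_eigenspaces_le) auto
    moreover have "1 \<le> ?d 0" using eigenspace_dim_ge v_eig e0 \<open>\<mu> = 0\<close> by blast
    ultimately show False using zero_less_card_finite[where 'a = 'n] by linarith
  qed
  ultimately have "0 < \<mu>" by simp
  then show thesis using that[of \<mu>] min by (simp add: U_def \<mu>_def)
qed

end


section \<open>The group generated by the reflections\<close>

locale coxeter_form =
  fixes m :: "'n::finite \<Rightarrow> 'n \<Rightarrow> enat" and B :: "real ^ 'n \<Rightarrow> real ^ 'n \<Rightarrow> real"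
  assumes coxeter: "coxeter_matrix m" and form: "associated_form m B"
begin

abbreviation act :: "'n list \<Rightarrow> real ^ 'n \<Rightarrow> real ^ 'n" where
  "act u \<equiv> foldr (reflection B) u"

sublocale symmetric_form B
  using form by unfold_locales (auto simp: associated_form_def)

lemma B_simple:
  "case m i j of
     enat k \<Rightarrow> B (simple_root i) (simple_root j) = - cos (pi / real k)
   | \<infinity> \<Rightarrow> B (simple_root i) (simple_root j) \<le> - 1"
  using form unfolding associated_form_def by blast

lemma B_simple_enat: "m i j = enat k \<Longrightarrow> B (simple_root i) (simple_root j) = - cos (pi / real k)"
  using B_simple[of i j] by simp

lemma B_simple_infinity: "m i j = \<infinity> \<Longrightarrow> B (simple_root i) (simple_root j) \<le> - 1"
  using B_simple[of i j] by simp

lemma B_simple_self [simp]: "B (simple_root i) (simple_root i) = 1"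
proof -
  have "m i i = enat 1"
    using coxeter by (simp add: coxeter_matrix_def one_enat_def)
  from B_simple_enat[OF this] show ?thesis by simp
qed

lemma m_ge_2: "i \<noteq> j \<Longrightarrow> m i j = enat k \<Longrightarrow> 2 \<le> k"
  using coxeter by (metis coxeter_matrix_def enat_ord_simps(1) numeral_eq_enat)

lemma B_simple_nonpos:
  assumes "i \<noteq> j"
  shows "B (simple_root i) (simple_root j) \<le> 0"
proof (cases "m i j")
  case (enat k)
  with m_ge_2[OF assms] have "2 \<le> k" by simp
  then have "pi / real k \<le> pi / 2" by (intro divide_left_mono) auto
  then have "0 \<le> cos (pi / real k)"
    by (intro cos_ge_zero) (auto intro: order_trans[of _ 0])
  then show ?thesis using B_simple_enat[OF enat] by simp
next
  case infinity
  then have "B (simple_root i) (simple_root j) \<le> - 1" by (rule B_simple_infinity)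
  then show ?thesis by simp
qed

lemma linear_reflection: "linear (reflection B i)"
  unfolding reflection_def
  by (rule linearI) (simp_all add: B_linear algebra_simps scaleR_add_left)

lemma linear_act: "linear (act u)"
proof (induction u)
  case (Cons a u)
  then show ?case using linear_compose[OF Cons linear_reflection] by (simp add: o_def)
qed (simp add: linear_iff)

lemma reflection_preserves: "B (reflection B i x) (reflection B i y) = B x y"
  by (simp add: reflection_def B_linear B_sym[of x "simple_root i"])

lemma act_preserves: "B (act u x) (act u y) = B x y"
  by (induction u) (auto simp: reflection_preserves)

lemma reflection_simple_self: "reflection B i (simple_root i) = - simple_root i"
  by (simp add: reflection_def scaleR_2)

lemma reflection_fixes: "B (simple_root i) v = 0 \<Longrightarrow> reflection B i v = v"
  by (simp add: reflection_def)

lemma act_alt_word_simple: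
  fixes n :: nat and x y :: 'n
  defines "c \<equiv> - B (simple_root x) (simple_root y)"
  shows "act (alt_word n x y) (simple_root (if even n then x else y)) =
         cheb c (Suc n) *\<^sub>R simple_root x + cheb c n *\<^sub>R simple_root y"
  unfolding c_def
proof (induction n arbitrary: x y)
  case (Suc n)
  define r where "r = act (alt_word n y x) (simple_root (if even (Suc n) then x else y))"
  have r: "r = cheb (- B (simple_root x) (simple_root y)) (Suc n) *\<^sub>R simple_root y +
               cheb (- B (simple_root x) (simple_root y)) n *\<^sub>R simple_root x"
    using Suc.IH[of y x]
    by (cases "even n") (simp_all add: r_def B_sym[of "simple_root y" "simple_root x"])
  have "act (alt_word (Suc n) x y) (simple_root (if even (Suc n) then x else y)) = reflection B x r"
    by (simp add: r_def)
  also have "\<dots> = cheb (- B (simple_root x) (simple_root y)) (Suc (Suc n)) *\<^sub>R simple_root x +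
                 cheb (- B (simple_root x) (simple_root y)) (Suc n) *\<^sub>R simple_root y"
    unfolding r reflection_def by (simp add: B_linear vec_eq_iff algebra_simps)
  finally show ?case .
qed simp

text \<open>
  If \<open>i \<noteq> j\<close> and \<open>m i j = k\<close> is finite, the form is nondegenerate on the plane of the two simple
  roots. The product of the two reflections fixes the orthogonal complement of that plane and
  rotates the plane by \<open>2 * pi / k\<close>.
\<close>

lemma act_relator:
  assumes k: "m i j = enat k"
  shows "act (concat (replicate k [i, j])) v = v"
proof (cases "i = j")
  case True
  then have "k = 1" using k coxeter by (simp add: coxeter_matrix_def one_enat_def)
  with True show ?thesis
    by (simp add: reflection_def B_linear scaleR_2)
next
  case False
  define \<theta> where "\<theta> = pi / real k"
  define c where "c = - B (simple_root i) (simple_root j)"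
  define T where "T = act (alt_word (2 * k) i j)"
  have k2: "2 \<le> k" using False k m_ge_2 by blast
  have c: "c = cos \<theta>" using B_simple_enat[OF k] by (simp add: c_def \<theta>_def)
  have s: "sin \<theta> \<noteq> 0"
    unfolding \<theta>_def using k2 sin_gt_zero[of "pi / real k"] by (auto simp: divide_simps)
  have kt: "real (2 * k) * \<theta> = 2 * pi" using k2 by (simp add: \<theta>_def)
  have ch0: "cheb c (2 * k) = 0"
    using cheb_cos[of \<theta> "2 * k"] s unfolding kt c by simp
  have "real (Suc (2 * k)) * \<theta> = 2 * pi + \<theta>" using kt by (simp add: algebra_simps)
  then have ch1: "cheb c (Suc (2 * k)) = 1"
    using cheb_cos[of \<theta> "Suc (2 * k)"] s c by (simp add: sin_add)
  have chm: "cheb c (2 * k - 1) = - 1"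
  proof -
    obtain l where "2 * k = Suc l" using k2 by (cases "2 * k") auto
    then show ?thesis using ch0 ch1 by simp
  qed
  have lin: "linear T" unfolding T_def by (rule linear_act)
  have Ti: "T (simple_root i) = simple_root i"
    using act_alt_word_simple[where n = "2 * k" and x = i and y = j] ch0 ch1
    by (simp add: T_def c_def)
  \<comment> \<open>The relator ends with \<open>j\<close>, which negates its own root; the remaining word is alternating.\<close>
  have Tj: "T (simple_root j) = simple_root j"
  proof -
    obtain l where l: "2 * k = Suc l" using k2 by (cases "2 * k") auto
    then have odd: "odd l" by presburger
    have "T (simple_root j) = act (alt_word l i j) (reflection B j (simple_root j))"
      using odd unfolding T_def l alt_word_Suc_snoc by simp
    also have "\<dots> = - act (alt_word l i j) (simple_root j)"
      by (simp add: reflection_simple_self linear_neg[OF linear_act])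
    also have "\<dots> = simple_root j"
      using act_alt_word_simple[where n = l and x = i and y = j] ch0 chm l odd
      by (simp add: c_def)
    finally show ?thesis .
  qed
  \<comment> \<open>Orthogonal projection to the plane; the Gram determinant is \<open>1 - c\<^sup>2 = (sin \<theta>)\<^sup>2\<close>.\<close>
  define p q where "p = B (simple_root i) v" and "q = B (simple_root j) v"
  define a b where "a = (p + c * q) / (1 - c\<^sup>2)" and "b = (q + c * p) / (1 - c\<^sup>2)"
  define u where "u = v - a *\<^sub>R simple_root i - b *\<^sub>R simple_root j"
  have det: "1 - c\<^sup>2 \<noteq> 0" using s c by (simp add: sin_squared_eq[symmetric])
  have ab: "a - c * b = p" "b - c * a = q"
  proof -
    have "a * (1 - c\<^sup>2) = p + c * q" "b * (1 - c\<^sup>2) = q + c * p"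
      using det by (simp_all add: a_def b_def)
    then have "(a - c * b) * (1 - c\<^sup>2) = p * (1 - c\<^sup>2)" "(b - c * a) * (1 - c\<^sup>2) = q * (1 - c\<^sup>2)"
      by (simp_all add: left_diff_distrib mult.assoc) (simp_all add: algebra_simps power2_eq_square)
    then show "a - c * b = p" "b - c * a = q" using det by simp_all
  qed
  have "B (simple_root i) u = 0" "B (simple_root j) u = 0"
    using ab by (simp_all add: u_def B_linear p_def q_def c_def B_sym[of "simple_root j" "simple_root i"]
        algebra_simps)
  then have fixes_u: "act w u = u" if "set w \<subseteq> {i, j}" for w
    using that by (induction w) (auto simp: reflection_fixes)
  have "T u = u"
    unfolding T_def by (rule fixes_u[OF set_alt_word])
  moreover have "v = u + a *\<^sub>R simple_root i + b *\<^sub>R simple_root j"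
    by (simp add: u_def)
  ultimately have "T v = v"
    using Ti Tj by (simp add: linear_add[OF lin] linear_scale[OF lin])
  then show ?thesis by (simp add: T_def concat_replicate_pair)
qed

lemma act_word_eq:
  assumes "word_eq m u v"
  shows "act u = act v"
  using assms
proof (induction rule: word_eq.induct)
  case (relation i j k u v)
  then show ?case by (simp add: act_relator fun_eq_iff)
qed simp_all

lemma group_action_word_class: "group_action B (word_class m u) v = act u v"
proof -
  have "(\<lambda>u. act u v) ` word_class m u = {act u v}"
    using act_word_eq by (auto simp: word_class_def intro: word_eq.refl image_eqI[where x = u])
  then show ?thesis by (simp add: group_action_def)
qed

lemma act_rev_act: "act (rev u) (act u v) = v"
  using act_word_eq[OF word_eq_rev_self[OF coxeter, of u]] by (simp add: fun_eq_iff)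


section \<open>Positive and negative roots\<close>

definition nonneg :: "real ^ 'n \<Rightarrow> bool" where
  "nonneg v \<longleftrightarrow> (\<forall>i. 0 \<le> v $ i)"

definition reduced :: "'n list \<Rightarrow> bool" where
  "reduced u \<longleftrightarrow> (\<forall>v. word_eq m u v \<longrightarrow> length u \<le> length v)"

lemma exists_reduced:
  obtains v where "word_eq m u v" "reduced v"
proof -
  define v where "v = (ARG_MIN length v. word_eq m u v)"
  have "word_eq m u v" unfolding v_def by (rule arg_min_natI) (rule word_eq.refl)
  moreover have "reduced v"
    unfolding reduced_def
  proof (intro allI impI)
    fix w assume "word_eq m v w"
    then have "word_eq m u w" using calculation word_eq.trans by blast
    then show "length v \<le> length w" unfolding v_def by (rule arg_min_nat_le)
  qed
  ultimately show thesis using that by blast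
qed

lemma reduced_appendD:
  assumes "reduced (u @ v)"
  shows "reduced u" "reduced v"
  unfolding reduced_def
  using assms word_eq_appendL word_eq_appendR
  by (fastforce simp: reduced_def)+

lemma reduced_distinct_adj:
  assumes "reduced u"
  shows "distinct_adj u"
proof (rule ccontr)
  assume "\<not> distinct_adj u"
  then obtain a b i where "u = a @ [i, i] @ b" by (rule not_distinct_adjE)
  moreover have "word_eq m (a @ [i, i] @ b) (a @ b)"
    by (rule word_eq_cancel_square[OF coxeter])
  ultimately show False using assms by (fastforce simp: reduced_def)
qed

text \<open>
  The relator is the alternating word with \<open>2 * k\<close> letters. Its first \<open>k + 1\<close> letters represent the
  inverse of the remaining \<open>k - 1\<close> letters, so an alternating word that contains them can be shortened.
\<close>

lemma reduced_alt_word_length: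
  assumes k: "m x y = enat k" and "reduced (alt_word n x y)"
  shows "n \<le> k"
proof (rule ccontr)
  assume "\<not> n \<le> k"
  then have "alt_word n x y = alt_word (Suc k) x y @
      (if even (Suc k) then alt_word (n - Suc k) x y else alt_word (n - Suc k) y x)"
    using alt_word_add[of "Suc k" "n - Suc k" x y] by simp
  with assms(2) have red: "reduced (alt_word (Suc k) x y)"
    using reduced_appendD(1) by metis
  have rel: "word_eq m (alt_word (2 * k) x y) []"
    using word_eq.relation[where m = m and i = x and j = y and k = k and u = "[]" and v = "[]"] k
    by (simp add: concat_replicate_pair)
  show False
  proof (cases k)
    case 0
    then show False using red m_ge_2[of x y] k coxeter
      by (cases "x = y") (auto simp: coxeter_matrix_def one_enat_def)
  next
    case (Suc l)
    define b where "b = (if even (Suc k) then alt_word l x y else alt_word l y x)"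
    have lb: "length b = l" by (simp add: b_def)
    have "alt_word (2 * k) x y = alt_word (Suc k) x y @ b"
      using alt_word_add[of "Suc k" l x y] Suc by (simp add: b_def mult_2)
    then have "word_eq m (alt_word (Suc k) x y @ b) []" using rel by simp
    then have "word_eq m (alt_word (Suc k) x y @ b @ rev b) (rev b)"
      using word_eq_appendR[of m "alt_word (Suc k) x y @ b" "[]" "rev b"] by simp
    moreover have "word_eq m (alt_word (Suc k) x y @ b @ rev b) (alt_word (Suc k) x y)"
      using word_eq_appendL[where a = "alt_word (Suc k) x y", OF word_eq_self_rev[OF coxeter, of b]]
      by simp
    ultimately have "word_eq m (alt_word (Suc k) x y) (rev b)"
      by (meson word_eq.sym word_eq.trans)
    then have "length (alt_word (Suc k) x y) \<le> length (rev b)"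
      using red unfolding reduced_def by blast
    then show False using lb Suc by simp
  qed
qed

text \<open>
  The coefficients are consecutive values of the Chebyshev polynomials. For a finite order \<open>k\<close> they
  are nonnegative as long as the index is at most \<open>k\<close>, which is what reducedness guarantees.
\<close>

lemma dihedral_root_nonneg:
  assumes "reduced (d @ [s])" "set d \<subseteq> {s, t}"
  obtains a b where "0 \<le> a" "0 \<le> b" "act d (simple_root s) = a *\<^sub>R simple_root s + b *\<^sub>R simple_root t"
proof -
  define n where "n = length d"
  obtain x y where xy: "{x, y} = {s, t}" and ds: "d @ [s] = alt_word (Suc n) x y"
    using alternating_word_two_letters[of "d @ [s]" s t] assms reduced_distinct_adj[OF assms(1)]
    by (auto simp: n_def)
  have d: "d = alt_word n x y" and s: "s = (if even n then x else y)"
    using ds unfolding alt_word_Suc_snoc by auto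
  define c where "c = - B (simple_root x) (simple_root y)"
  have "0 \<le> cheb c (Suc n) \<and> 0 \<le> cheb c n"
  proof (cases "x = y")
    case True
    have "n = 0"
    proof (cases n)
      case (Suc l)
      then have "\<not> distinct_adj (d @ [s])" using ds True by (simp add: distinct_adj_Cons)
      then show ?thesis using reduced_distinct_adj[OF assms(1)] by blast
    qed simp
    then show ?thesis by simp
  next
    case False
    show ?thesis
    proof (cases "m x y")
      case (enat k)
      then have "2 \<le> k" using m_ge_2[OF False] by blast
      moreover have "Suc n \<le> k"
        using reduced_alt_word_length[OF enat, of "Suc n"] assms(1) ds by simp
      moreover have "c = cos (pi / real k)" using B_simple_enat[OF enat] by (simp add: c_def)
      ultimately show ?thesis using cheb_nonneg_cos[of k n] cheb_nonneg_cos[of k "Suc n"] by simp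
    next
      case infinity
      then have "1 \<le> c" using B_simple_infinity[OF infinity] by (simp add: c_def)
      then show ?thesis using cheb_nonneg_ge_1 by blast
    qed
  qed
  moreover have "act d (simple_root s) = cheb c (Suc n) *\<^sub>R simple_root x + cheb c n *\<^sub>R simple_root y"
    using act_alt_word_simple[where n = n and x = x and y = y] by (simp add: d s[symmetric] c_def)
  moreover have "x = s \<and> y = t \<or> x = t \<and> y = s" using xy by (auto simp: doubleton_eq_iff)
  ultimately show thesis using that by (metis add.commute)
qed

text \<open>
  Let \<open>t\<close> be the last letter of \<open>u\<close>. Then \<open>u\<close> is split as \<open>v @ d\<close> with \<open>d\<close> a word in \<open>s\<close> and \<open>t\<close> and
  with \<open>v\<close> as short as possible. Neither \<open>s\<close> nor \<open>t\<close> shortens \<open>v\<close>, so by induction \<open>v\<close> maps both simple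
  roots to nonnegative vectors. In the dihedral group of \<open>s\<close> and \<open>t\<close>, the word \<open>d\<close> maps the root of \<open>s\<close>
  to a nonnegative combination of these two roots.
\<close>

lemma reduced_snoc_root_nonneg:
  assumes "reduced (u @ [s])"
  shows "nonneg (act u (simple_root s))"
  using assms
proof (induction "length u" arbitrary: u s rule: less_induct)
  case less
  have red_u: "reduced u" using less.prems reduced_appendD by blast
  show ?case
  proof (cases u rule: rev_cases)
    case Nil
    then show ?thesis by (auto simp: nonneg_def axis_def)
  next
    case (snoc u0 t)
    define splits where "splits = (\<lambda>v. \<exists>d. set d \<subseteq> {s, t} \<and> word_eq m u (v @ d) \<and>
        length v + length d = length u)"
    have init: "splits u0"
      unfolding splits_def using snoc by (intro exI[of _ "[t]"]) (auto intro: word_eq.refl)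
    define v where "v = (ARG_MIN length v. splits v)"
    have "splits v" unfolding v_def by (rule arg_min_natI) (rule init)
    then obtain d where d: "set d \<subseteq> {s, t}" "word_eq m u (v @ d)" "length v + length d = length u"
      unfolding splits_def by blast
    have v_min: "length v \<le> length w" if "splits w" for w
      unfolding v_def using that by (rule arg_min_nat_le)
    have v_short: "length v < length u" using v_min[OF init] snoc by simp
    have red_vr: "reduced (v @ [r])" if r: "r \<in> {s, t}" for r
    proof (rule ccontr)
      assume "\<not> reduced (v @ [r])"
      then obtain w where w: "word_eq m (v @ [r]) w" "length w \<le> length v"
        by (auto simp: reduced_def not_le)
      \<comment> \<open>Parity excludes that \<open>w\<close> and \<open>v\<close> have the same length.\<close>
      have "even (length w) \<longleftrightarrow> odd (length v)" using word_eq_parity[OF w(1)] by simp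
      then have lw: "length w < length v" using w(2) by (metis le_neq_implies_less)
      have "word_eq m (v @ d) (v @ [r, r] @ d)"
        using word_eq_cancel_square[OF coxeter] word_eq.sym by blast
      moreover have "word_eq m (v @ [r, r] @ d) (w @ r # d)"
        using word_eq_appendR[OF w(1), of "r # d"] by simp
      ultimately have eq: "word_eq m u (w @ r # d)" using d(2) word_eq.trans by blast
      then have "length u \<le> length (w @ r # d)" using red_u unfolding reduced_def by blast
      then have "length w + length (r # d) = length u" using lw d(3) by simp
      then have "splits w" unfolding splits_def using eq r d(1) by (intro exI[of _ "r # d"]) auto
      then show False using v_min lw by fastforce
    qed
    have pos: "nonneg (act v (simple_root s))" "nonneg (act v (simple_root t))"
      using less.hyps[OF v_short] red_vr by auto
    have "reduced (d @ [s])"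
      unfolding reduced_def
    proof (intro allI impI)
      fix e assume "word_eq m (d @ [s]) e"
      then have "word_eq m (v @ d @ [s]) (v @ e)" by (rule word_eq_appendL)
      moreover have "word_eq m (u @ [s]) (v @ d @ [s])" using word_eq_appendR[OF d(2)] by simp
      ultimately have "word_eq m (u @ [s]) (v @ e)" using word_eq.trans by blast
      then have "length (u @ [s]) \<le> length (v @ e)" using less.prems unfolding reduced_def by blast
      then show "length (d @ [s]) \<le> length e" using d(3) by simp
    qed
    then obtain a b where ab: "0 \<le> a" "0 \<le> b"
      "act d (simple_root s) = a *\<^sub>R simple_root s + b *\<^sub>R simple_root t"
      using dihedral_root_nonneg d(1) by blast
    have "act u (simple_root s) = a *\<^sub>R act v (simple_root s) + b *\<^sub>R act v (simple_root t)"
      using act_word_eq[OF d(2)] ab(3)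
      by (simp add: linear_add[OF linear_act] linear_scale[OF linear_act])
    then show ?thesis using ab(1,2) pos by (simp add: nonneg_def)
  qed
qed

text \<open>
  The last letter \<open>s\<close> of a reduced word for \<open>u\<close> maps its own root to the negative, and the remaining
  letters map the root to a nonnegative vector.
\<close>

lemma exists_negative_root:
  assumes "act u \<noteq> id"
  obtains s where "nonneg (- act u (simple_root s))"
proof -
  obtain v where v: "word_eq m u v" "reduced v" by (rule exists_reduced)
  have act: "act u = act v" using act_word_eq[OF v(1)] .
  show thesis
  proof (cases v rule: rev_cases)
    case Nil
    then show ?thesis using assms act by (auto simp: id_def)
  next
    case (snoc w s)
    have "nonneg (act w (simple_root s))" using reduced_snoc_root_nonneg v(2) snoc by blast
    moreover have "act v (simple_root s) = - act w (simple_root s)"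
      by (simp add: snoc reflection_simple_self linear_neg[OF linear_act])
    ultimately show ?thesis using that[of s] act by simp
  qed
qed

end


section \<open>Lorentzian geometry\<close>

text \<open>
  The vector \<open>e\<close> stands for the normalized eigenvector of the only negative eigenvalue \<open>-\<kappa>\<close>, so the
  inner product with \<open>e\<close> is the height, and \<open>\<mu>\<close> bounds the positive eigenvalues from below.
\<close>

locale lorentz_form = symmetric_form B
  for B :: "real ^ 'n::finite \<Rightarrow> real ^ 'n \<Rightarrow> real" +
  fixes e :: "real ^ 'n" and \<kappa> \<mu> :: real
  assumes norm_e: "norm e = 1"
    and B_e: "B x e = - \<kappa> * (x \<bullet> e)"
    and \<kappa>_pos: "0 < \<kappa>"
    and \<mu>_pos: "0 < \<mu>"
    and B_complement: "u \<bullet> e = 0 \<Longrightarrow> \<mu> * (u \<bullet> u) \<le> B u u"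
begin

lemma e_e: "e \<bullet> e = 1"
  using norm_e by (simp add: dot_square_norm)

lemma B_e': "B e x = - \<kappa> * (x \<bullet> e)"
  using B_e B_sym by metis

lemma split_along_e:
  obtains u where "u \<bullet> e = 0" "B x x = - \<kappa> * (x \<bullet> e)\<^sup>2 + B u u" "(norm x)\<^sup>2 = (x \<bullet> e)\<^sup>2 + (norm u)\<^sup>2"
proof -
  define u where "u = x - (x \<bullet> e) *\<^sub>R e"
  have x: "x = (x \<bullet> e) *\<^sub>R e + u" and ue: "u \<bullet> e = 0"
    by (simp_all add: u_def inner_simps e_e)
  have "B x x = B ((x \<bullet> e) *\<^sub>R e + u) ((x \<bullet> e) *\<^sub>R e + u)"
    using x by simp
  also have "\<dots> = - \<kappa> * (x \<bullet> e)\<^sup>2 + B u u"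
    by (simp add: B_linear B_e B_e' inner_simps ue e_e power2_eq_square)
  finally have B: "B x x = - \<kappa> * (x \<bullet> e)\<^sup>2 + B u u" .
  have "x \<bullet> x = ((x \<bullet> e) *\<^sub>R e + u) \<bullet> ((x \<bullet> e) *\<^sub>R e + u)"
    using x by simp
  also have "\<dots> = (x \<bullet> e)\<^sup>2 + u \<bullet> u"
    by (simp add: inner_simps ue e_e inner_commute[of e u] power2_eq_square)
  finally have "(norm x)\<^sup>2 = (x \<bullet> e)\<^sup>2 + (norm u)\<^sup>2" by (simp add: dot_square_norm)
  with ue B show thesis by (rule that)
qed

lemma complement_norm: "u \<bullet> e = 0 \<Longrightarrow> \<mu> * (norm u)\<^sup>2 \<le> B u u"
  using B_complement[of u] by (simp add: dot_square_norm)

lemma B_ge_height: "- \<kappa> * (x \<bullet> e)\<^sup>2 \<le> B x x"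
proof -
  obtain u where u: "u \<bullet> e = 0" "B x x = - \<kappa> * (x \<bullet> e)\<^sup>2 + B u u" by (rule split_along_e)
  have "0 \<le> \<mu> * (norm u)\<^sup>2" using \<mu>_pos by simp
  with u complement_norm[OF u(1)] show ?thesis by linarith
qed

lemma height_nonzero:
  assumes "B x x \<le> 0" "x \<noteq> 0"
  shows "x \<bullet> e \<noteq> 0"
proof
  assume "x \<bullet> e = 0"
  then have "\<mu> * (norm x)\<^sup>2 \<le> 0" using complement_norm assms(1) by fastforce
  then show False using \<mu>_pos assms(2) by (simp add: mult_le_0_iff)
qed

lemma norm_le_height:
  assumes "B x x \<le> 0"
  shows "\<mu> * (norm x)\<^sup>2 \<le> (\<mu> + \<kappa>) * (x \<bullet> e)\<^sup>2"
proof -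
  obtain u where u: "u \<bullet> e = 0" "B x x = - \<kappa> * (x \<bullet> e)\<^sup>2 + B u u"
    "(norm x)\<^sup>2 = (x \<bullet> e)\<^sup>2 + (norm u)\<^sup>2" by (rule split_along_e)
  have "\<mu> * (norm x)\<^sup>2 = \<mu> * (x \<bullet> e)\<^sup>2 + \<mu> * (norm u)\<^sup>2" by (simp add: u(3) distrib_left)
  with u(2) complement_norm[OF u(1)] assms show ?thesis by (simp add: algebra_simps)
qed

text \<open>
  Two vectors of the same height differ by a vector of the positive definite complement, and the
  form of the difference is expanded. This compares directions of timelike vectors by means of
  their product, which isometries preserve.
\<close>

lemma timelike_direction_ineq:
  assumes "B x x < 0" "B y y < 0"
  defines "p \<equiv> x \<bullet> e" and "q \<equiv> y \<bullet> e"
  shows "\<mu> * (norm (x /\<^sub>R p - y /\<^sub>R q))\<^sup>2 \<le> B x x / p\<^sup>2 + B y y / q\<^sup>2 - 2 * B x y / (p * q)"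
proof -
  have "x \<noteq> 0" "y \<noteq> 0" using assms by (auto simp: B_linear)
  then have pq: "p \<noteq> 0" "q \<noteq> 0" unfolding p_def q_def using assms height_nonzero by auto
  define u where "u = x /\<^sub>R p - y /\<^sub>R q"
  have "u \<bullet> e = 0" using pq by (simp add: u_def inner_simps p_def[symmetric] q_def[symmetric])
  from complement_norm[OF this] show ?thesis
    unfolding u_def using pq
    by (simp add: B_linear B_sym[of y x] field_simps power2_eq_square)
qed

lemma timelike_direction_dist:
  assumes "B x x < 0" "B y y < 0"
  shows "\<mu> * (norm (x /\<^sub>R (x \<bullet> e) - y /\<^sub>R (y \<bullet> e)))\<^sup>2 \<le> 2 * \<bar>B x y\<bar> / (\<bar>x \<bullet> e\<bar> * \<bar>y \<bullet> e\<bar>)"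
proof -
  have "B x x / (x \<bullet> e)\<^sup>2 \<le> 0" "B y y / (y \<bullet> e)\<^sup>2 \<le> 0"
    using assms by (simp_all add: divide_nonpos_nonneg)
  moreover have "- (2 * B x y / ((x \<bullet> e) * (y \<bullet> e))) \<le> 2 * \<bar>B x y\<bar> / (\<bar>x \<bullet> e\<bar> * \<bar>y \<bullet> e\<bar>)"
    using abs_ge_minus_self[of "2 * B x y / ((x \<bullet> e) * (y \<bullet> e))"] by (simp add: abs_mult)
  ultimately show ?thesis using timelike_direction_ineq[OF assms] by linarith
qed

lemma timelike_height_compare:
  assumes "B x x < 0" "B y y < 0"
  shows "- B x x * \<bar>y \<bullet> e\<bar> \<le> 2 * \<bar>B x y\<bar> * \<bar>x \<bullet> e\<bar>"
proof -
  have "x \<noteq> 0" "y \<noteq> 0" using assms by (auto simp: B_linear)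
  then have pq: "x \<bullet> e \<noteq> 0" "y \<bullet> e \<noteq> 0" using assms height_nonzero by auto
  have "0 \<le> \<mu> * (norm (x /\<^sub>R (x \<bullet> e) - y /\<^sub>R (y \<bullet> e)))\<^sup>2" using \<mu>_pos by simp
  moreover have "B y y / (y \<bullet> e)\<^sup>2 \<le> 0"
    using assms by (simp add: divide_nonpos_nonneg)
  moreover have "- (2 * B x y / ((x \<bullet> e) * (y \<bullet> e))) \<le> 2 * \<bar>B x y\<bar> / (\<bar>x \<bullet> e\<bar> * \<bar>y \<bullet> e\<bar>)"
    using abs_ge_minus_self[of "2 * B x y / ((x \<bullet> e) * (y \<bullet> e))"] by (simp add: abs_mult)
  ultimately have "- (B x x / (x \<bullet> e)\<^sup>2) \<le> 2 * \<bar>B x y\<bar> / (\<bar>x \<bullet> e\<bar> * \<bar>y \<bullet> e\<bar>)"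
    using timelike_direction_ineq[OF assms] by linarith
  then have "- (B x x / \<bar>x \<bullet> e\<bar>\<^sup>2) * (\<bar>x \<bullet> e\<bar>\<^sup>2 * \<bar>y \<bullet> e\<bar>)
      \<le> 2 * \<bar>B x y\<bar> / (\<bar>x \<bullet> e\<bar> * \<bar>y \<bullet> e\<bar>) * (\<bar>x \<bullet> e\<bar>\<^sup>2 * \<bar>y \<bullet> e\<bar>)"
    by (intro mult_right_mono) simp_all
  moreover have "- (B x x / \<bar>x \<bullet> e\<bar>\<^sup>2) * (\<bar>x \<bullet> e\<bar>\<^sup>2 * \<bar>y \<bullet> e\<bar>) = - B x x * \<bar>y \<bullet> e\<bar>"
    using pq by simp
  moreover have "2 * \<bar>B x y\<bar> / (\<bar>x \<bullet> e\<bar> * \<bar>y \<bullet> e\<bar>) * (\<bar>x \<bullet> e\<bar>\<^sup>2 * \<bar>y \<bullet> e\<bar>) = 2 * \<bar>B x y\<bar> * \<bar>x \<bullet> e\<bar>"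
  proof -
    have "2 * t / (p * q) * (p\<^sup>2 * q) = 2 * t * p" if "p \<noteq> 0" "q \<noteq> 0" for t p q :: real
      using that by (simp add: power2_eq_square)
    then show ?thesis using pq by (metis abs_eq_0)
  qed
  ultimately show ?thesis by simp
qed

text \<open>
  The form of \<open>x - e\<close> equals \<open>2 * \<kappa> * (x \<bullet> e - 1)\<close> and so determines the height of \<open>x\<close>. On the
  hyperboloid through \<open>e\<close>, the height in turn determines the length of the component orthogonal to \<open>e\<close>.
\<close>

lemma hyperboloid_dist:
  assumes "B x x = - \<kappa>"
  defines "s \<equiv> \<bar>B (x - e) (x - e)\<bar> / (2 * \<kappa>)"
  shows "\<mu> * (norm (x - e))\<^sup>2 \<le> 2 * \<kappa> * s + (\<mu> + \<kappa>) * s\<^sup>2"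
proof -
  define t where "t = x \<bullet> e - 1"
  have Bt: "B (x - e) (x - e) = 2 * \<kappa> * t"
    using assms(1) by (simp add: t_def B_linear B_e B_e' e_e algebra_simps)
  then have st: "s = \<bar>t\<bar>" using \<kappa>_pos by (simp add: s_def abs_mult)
  have te: "(x - e) \<bullet> e = t" by (simp add: t_def inner_simps e_e)
  obtain u where u: "u \<bullet> e = 0" "B (x - e) (x - e) = - \<kappa> * t\<^sup>2 + B u u"
    "(norm (x - e))\<^sup>2 = t\<^sup>2 + (norm u)\<^sup>2" using split_along_e[of "x - e"] te by metis
  have "\<mu> * (norm (x - e))\<^sup>2 = \<mu> * t\<^sup>2 + \<mu> * (norm u)\<^sup>2" by (simp add: u(3) distrib_left)
  also have "\<dots> \<le> \<mu> * t\<^sup>2 + (2 * \<kappa> * t + \<kappa> * t\<^sup>2)"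
    using complement_norm[OF u(1)] u(2) Bt by simp
  also have "\<dots> \<le> 2 * \<kappa> * s + (\<mu> + \<kappa>) * s\<^sup>2"
    using \<kappa>_pos by (simp add: st distrib_right)
  finally show ?thesis .
qed

end


section \<open>Discreteness and convergence of orbits\<close>

locale lorentz_coxeter_form = coxeter_form m B + lorentz_form B e \<kappa> \<mu>
  for m :: "'n::finite \<Rightarrow> 'n \<Rightarrow> enat" and B :: "real ^ 'n \<Rightarrow> real ^ 'n \<Rightarrow> real"
    and e :: "real ^ 'n" and \<kappa> \<mu> :: real +
  assumes e_pos: "0 < e $ i"
begin

text \<open>
  The vector \<open>-e\<close> lies in the interior of the fundamental chamber. If all products of \<open>act u e\<close>
  with simple roots were nonpositive, then its product with the negative root \<open>act u (simple_root s)\<close>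
  would be nonnegative, whereas this product is that of \<open>e\<close> with \<open>simple_root s\<close>.
\<close>

lemma act_e_leaves_chamber:
  assumes "act u \<noteq> id"
  obtains i where "0 < B (act u e) (simple_root i)"
proof (rule ccontr)
  assume "\<not> thesis"
  then have nonpos: "B (act u e) (simple_root i) \<le> 0" for i using that not_le by blast
  obtain s where s: "nonneg (- act u (simple_root s))" by (rule exists_negative_root[OF assms])
  have "0 \<le> (\<Sum>i\<in>UNIV. B (act u e) (simple_root i) * act u (simple_root s) $ i)"
    using nonpos s by (intro sum_nonneg mult_nonpos_nonpos) (auto simp: nonneg_def)
  also have "\<dots> = B (act u e) (act u (simple_root s))"
    by (rule B_expand_right[symmetric]) (simp add: root_span_UNIV)
  also have "\<dots> = - \<kappa> * e $ s"
    by (simp add: act_preserves B_e' inner_axis')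
  also have "\<dots> < 0" using \<kappa>_pos e_pos by simp
  finally show False by simp
qed

text \<open>
  All products of \<open>e\<close> with simple roots are bounded above by a fixed negative number, so that leaving
  the chamber requires a displacement of definite size.
\<close>

lemma act_e_away_from_e:
  obtains \<delta> where "0 < \<delta>" "\<And>u. act u \<noteq> id \<Longrightarrow> \<delta> \<le> norm (act u e - e)"
proof -
  obtain K where K: "0 < K" "\<And>x y. \<bar>B x y\<bar> \<le> K * norm x * norm y" by (rule B_bound) blast
  define c where "c = Min (range (($) e))"
  have c: "0 < c" "c \<le> e $ i" for i unfolding c_def using e_pos by auto
  have "\<kappa> * c / K \<le> norm (act u e - e)" if u: "act u \<noteq> id" for u
  proof -
    obtain i where i: "0 < B (act u e) (simple_root i)" by (rule act_e_leaves_chamber[OF u])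
    have "\<kappa> * c \<le> \<kappa> * e $ i" using c(2)[of i] \<kappa>_pos by simp
    also have "\<dots> \<le> B (act u e - e) (simple_root i)"
      using i by (simp add: B_linear B_e' inner_axis')
    also have "\<dots> \<le> K * norm (act u e - e)"
      using K(2)[of "act u e - e" "simple_root i"] by simp
    finally show ?thesis using K(1) by (simp add: divide_simps mult_ac)
  qed
  moreover have "0 < \<kappa> * c / K" using \<kappa>_pos c K by simp
  ultimately show thesis using that by blast
qed

lemma act_eq_iff: "act (rev v @ u) = id \<longleftrightarrow> act u = act v"
proof
  assume "act (rev v @ u) = id"
  then have "act (rev v) (act u x) = x" for x by (simp add: fun_eq_iff)
  then have "act v (act (rev v) (act u x)) = act v x" for x by simp
  then show "act u = act v" using act_rev_act[of "rev v"] by (simp add: fun_eq_iff)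
next
  assume "act u = act v"
  then show "act (rev v @ u) = id" by (simp add: fun_eq_iff act_rev_act)
qed

text \<open>
  The Euclidean distance of two orbit points is not invariant under the group, but the form of their
  difference is. If \<open>act u e\<close> and \<open>act v e\<close> are close, then this form is small, and \<open>hyperboloid_dist\<close>
  translates this back into a small Euclidean distance of \<open>e\<close> from its image under the quotient of the
  two group elements.
\<close>

lemma orbit_e_uniformly_discrete:
  obtains \<epsilon> where "0 < \<epsilon>" "\<And>u v. norm (act u e - act v e) < \<epsilon> \<Longrightarrow> act u = act v"
proof -
  obtain K where K: "0 < K" "\<And>x y. \<bar>B x y\<bar> \<le> K * norm x * norm y" by (rule B_bound) blast
  obtain \<delta> where \<delta>: "0 < \<delta>" "\<And>u. act u \<noteq> id \<Longrightarrow> \<delta> \<le> norm (act u e - e)"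
    by (rule act_e_away_from_e) blast
  \<comment> \<open>For orbit points at distance \<open>r\<close>, \<open>S r\<close> bounds the number \<open>s\<close> of \<open>hyperboloid_dist\<close>.\<close>
  define S where "S r = K * r\<^sup>2 / (2 * \<kappa>)" for r
  define F where "F r = 2 * \<kappa> * S r + (\<mu> + \<kappa>) * (S r)\<^sup>2" for r
  have "(F \<longlongrightarrow> F 0) (at 0)"
    unfolding F_def S_def using \<kappa>_pos by (intro tendsto_intros) auto
  moreover have "F 0 = 0" by (simp add: F_def S_def)
  moreover have "0 < \<mu> * \<delta>\<^sup>2" using \<mu>_pos \<delta>(1) by simp
  ultimately obtain \<epsilon> where \<epsilon>: "0 < \<epsilon>" "\<And>r. r \<noteq> 0 \<Longrightarrow> \<bar>r\<bar> < \<epsilon> \<Longrightarrow> \<bar>F r\<bar> < \<mu> * \<delta>\<^sup>2"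
    using LIM_D[of F 0 0 "\<mu> * \<delta>\<^sup>2"] by auto
  have "act u = act v" if uv: "norm (act u e - act v e) < \<epsilon>" for u v
  proof (rule ccontr)
    assume ne: "act u \<noteq> act v"
    define r where "r = norm (act u e - act v e)"
    define x where "x = act (rev v @ u) e"
    have Bx: "B x x = - \<kappa>"
      unfolding x_def act_preserves by (simp add: B_e e_e)
    have "x - e = act (rev v) (act u e - act v e)"
      by (simp add: x_def linear_diff[OF linear_act] act_rev_act)
    then have "\<bar>B (x - e) (x - e)\<bar> \<le> K * r\<^sup>2"
      using K(2)[of "act u e - act v e" "act u e - act v e"]
      by (simp add: act_preserves r_def power2_eq_square)
    then have s: "\<bar>B (x - e) (x - e)\<bar> / (2 * \<kappa>) \<le> S r"
      using \<kappa>_pos by (simp add: S_def divide_right_mono)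
    have "\<delta> \<le> norm (x - e)"
      unfolding x_def using \<delta>(2) ne act_eq_iff by blast
    then have "\<mu> * \<delta>\<^sup>2 \<le> \<mu> * (norm (x - e))\<^sup>2"
      using \<delta>(1) \<mu>_pos by (simp add: power_mono)
    also have "\<dots> \<le> F r"
      unfolding F_def
      using \<kappa>_pos \<mu>_pos s
      by (intro order_trans[OF hyperboloid_dist[OF Bx]] add_mono mult_left_mono power_mono) auto
    finally have F: "\<mu> * \<delta>\<^sup>2 \<le> F r" .
    show False
    proof (cases "r = 0")
      case True
      then show False using F \<open>F 0 = 0\<close> \<open>0 < \<mu> * \<delta>\<^sup>2\<close> by simp
    next
      case False
      then show False using \<epsilon>(2)[of r] uv F by (simp add: r_def)
    qed
  qed
  then show thesis using that \<epsilon>(1) by blast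
qed

text \<open>
  If a limit of rescaled orbit points of \<open>z\<close> were timelike, the heights of the orbit points of \<open>z\<close>
  would stay bounded, hence also the corresponding orbit points of \<open>e\<close>. By discreteness infinitely
  many of the group elements would then coincide.
\<close>

lemma orbit_accumulates_on_cone:
  fixes c :: "real ^ 'n \<Rightarrow> real" and u :: "nat \<Rightarrow> 'n list"
  assumes z: "B z z < 0"
    and lim: "(\<lambda>k. c (act (u k) z) *\<^sub>R act (u k) z) \<longlonglongrightarrow> \<xi>"
    and ne: "\<And>k. c (act (u k) z) *\<^sub>R act (u k) z \<noteq> \<xi>"
  shows "B \<xi> \<xi> = 0"
proof (rule ccontr)
  assume not0: "B \<xi> \<xi> \<noteq> 0"
  define X where "X k = act (u k) z" for k
  define f where "f k = c (X k) *\<^sub>R X k" for k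
  have f_lim: "f \<longlonglongrightarrow> \<xi>" and f_ne: "\<And>k. f k \<noteq> \<xi>"
    using lim ne by (simp_all add: f_def[abs_def] X_def)
  have BX: "B (X k) (X k) = B z z" for k by (simp add: X_def act_preserves)
  have Bf: "B (f k) (f k) = (c (X k))\<^sup>2 * B z z" for k
    by (simp add: f_def B_linear BX power2_eq_square)
  have Bf_lim: "(\<lambda>k. B (f k) (f k)) \<longlonglongrightarrow> B \<xi> \<xi>" by (intro tendsto_B f_lim)
  have he: "(X k \<bullet> e)\<^sup>2 = (f k \<bullet> e)\<^sup>2 * B z z / B (f k) (f k)" if "B (f k) (f k) \<noteq> 0" for k
  proof -
    have "f k \<bullet> e = c (X k) * (X k \<bullet> e)" by (simp add: f_def)
    then show ?thesis using that by (simp add: Bf power_mult_distrib)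
  qed
  have "(\<lambda>k. (f k \<bullet> e)\<^sup>2 * B z z / B (f k) (f k)) \<longlonglongrightarrow> (\<xi> \<bullet> e)\<^sup>2 * B z z / B \<xi> \<xi>"
    by (intro tendsto_intros f_lim Bf_lim not0)
  moreover have "eventually (\<lambda>k. (f k \<bullet> e)\<^sup>2 * B z z / B (f k) (f k) = (X k \<bullet> e)\<^sup>2) sequentially"
    using tendsto_imp_eventually_ne[OF Bf_lim not0] by eventually_elim (simp add: he)
  ultimately have "(\<lambda>k. (X k \<bullet> e)\<^sup>2) \<longlonglongrightarrow> (\<xi> \<bullet> e)\<^sup>2 * B z z / B \<xi> \<xi>"
    by (rule Lim_transform_eventually)
  then have "Bseq (\<lambda>k. (X k \<bullet> e)\<^sup>2)" by (intro convergent_imp_Bseq convergentI)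
  then obtain M where M: "\<And>k. (X k \<bullet> e)\<^sup>2 \<le> M" by (auto simp: Bseq_def)
  define Z where "Z k = act (u k) e" for k
  have BZ: "B (Z k) (Z k) = - \<kappa>" "B (X k) (Z k) = B z e" for k
    by (simp_all add: Z_def X_def act_preserves B_e e_e)
  have Z_bound: "\<mu> * (norm (Z k))\<^sup>2 \<le> (\<mu> + \<kappa>) * ((2 * \<bar>B z e\<bar>)\<^sup>2 * M / (B z z)\<^sup>2)" for k
  proof -
    have "- B z z * \<bar>Z k \<bullet> e\<bar> \<le> 2 * \<bar>B z e\<bar> * \<bar>X k \<bullet> e\<bar>"
      using timelike_height_compare[of "X k" "Z k"] z \<kappa>_pos by (simp add: BX BZ)
    then have "(- B z z * \<bar>Z k \<bullet> e\<bar>)\<^sup>2 \<le> (2 * \<bar>B z e\<bar> * \<bar>X k \<bullet> e\<bar>)\<^sup>2"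
      using z by (intro power_mono) (auto simp: mult_nonpos_nonneg)
    also have "\<dots> \<le> (2 * \<bar>B z e\<bar>)\<^sup>2 * M"
      unfolding power_mult_distrib[of "2 * \<bar>B z e\<bar>"] using M[of k] by (intro mult_left_mono) auto
    finally have "(Z k \<bullet> e)\<^sup>2 \<le> (2 * \<bar>B z e\<bar>)\<^sup>2 * M / (B z z)\<^sup>2"
      using z by (simp add: pos_le_divide_eq power_mult_distrib mult.commute)
    then have "(\<mu> + \<kappa>) * (Z k \<bullet> e)\<^sup>2 \<le> (\<mu> + \<kappa>) * ((2 * \<bar>B z e\<bar>)\<^sup>2 * M / (B z z)\<^sup>2)"
      using \<kappa>_pos \<mu>_pos by (intro mult_left_mono) auto
    moreover have "\<mu> * (norm (Z k))\<^sup>2 \<le> (\<mu> + \<kappa>) * (Z k \<bullet> e)\<^sup>2"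
      using \<kappa>_pos by (intro norm_le_height) (simp add: BZ)
    ultimately show ?thesis by linarith
  qed
  obtain R where R: "\<And>k. (norm (Z k))\<^sup>2 \<le> R"
  proof -
    have "(norm (Z k))\<^sup>2 \<le> (\<mu> + \<kappa>) * ((2 * \<bar>B z e\<bar>)\<^sup>2 * M / (B z z)\<^sup>2) / \<mu>" for k
      using \<mu>_pos Z_bound[of k, unfolded mult.commute[of \<mu> "(norm (Z k))\<^sup>2"]]
      by (rule mult_imp_le_div_pos)
    then show thesis using that by blast
  qed
  have "norm (Z k) \<le> sqrt R" for k using R[of k] by (rule real_le_rsqrt)
  then have "bounded (range Z)" by (auto simp: bounded_iff)
  then obtain l r where r: "strict_mono (r :: nat \<Rightarrow> nat)" "(Z \<circ> r) \<longlonglongrightarrow> l"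
    using bounded_imp_convergent_subsequence by blast
  obtain \<epsilon> where \<epsilon>: "0 < \<epsilon>" "\<And>u v. norm (act u e - act v e) < \<epsilon> \<Longrightarrow> act u = act v"
    by (rule orbit_e_uniformly_discrete) blast
  have "Cauchy (Z \<circ> r)" using r(2) by (rule LIMSEQ_imp_Cauchy)
  then obtain N where N: "\<And>i j. N \<le> i \<Longrightarrow> N \<le> j \<Longrightarrow> norm (Z (r i) - Z (r j)) < \<epsilon>"
    using \<epsilon>(1) unfolding Cauchy_iff by (metis comp_apply)
  have stable: "(f \<circ> r) j = f (r N)" if "N \<le> j" for j
  proof -
    have "act (u (r j)) = act (u (r N))"
      using N[OF that order_refl] \<epsilon>(2) by (simp add: Z_def)
    then show ?thesis by (simp add: f_def X_def)
  qed
  have "eventually (\<lambda>j. (f \<circ> r) j = f (r N)) sequentially"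
    by (rule eventually_sequentiallyI) (rule stable)
  then have "(f \<circ> r) \<longlonglongrightarrow> f (r N)" by (rule tendsto_eventually)
  moreover have "(f \<circ> r) \<longlonglongrightarrow> \<xi>" using f_lim r(1) by (rule LIMSEQ_subseq_LIMSEQ)
  ultimately show False using f_ne LIMSEQ_unique by blast
qed

text \<open>
  If rescaled orbit points of \<open>z\<close> tend to the light cone, their heights tend to infinity. The
  corresponding orbit points of \<open>e\<close> have a fixed product with them, so both sequences have the same
  limiting direction.
\<close>

lemma orbit_directions_converge:
  fixes c :: "nat \<Rightarrow> real" and u :: "nat \<Rightarrow> 'n list"
  assumes z: "B z z < 0"
    and lim: "(\<lambda>k. c k *\<^sub>R act (u k) z) \<longlonglongrightarrow> \<xi>" and \<xi>: "\<xi> \<noteq> 0" "B \<xi> \<xi> = 0"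
  shows "(\<lambda>k. act (u k) e /\<^sub>R (act (u k) e \<bullet> e)) \<longlonglongrightarrow> \<xi> /\<^sub>R (\<xi> \<bullet> e)"
proof -
  define X where "X k = act (u k) z" for k
  define Z where "Z k = act (u k) e" for k
  define f where "f k = c k *\<^sub>R X k" for k
  have f_lim: "f \<longlonglongrightarrow> \<xi>" using lim by (simp add: f_def[abs_def] X_def)
  have BX: "B (X k) (X k) = B z z" and BZ: "B (Z k) (Z k) = - \<kappa>" and BXZ: "B (X k) (Z k) = B z e" for k
    by (simp_all add: X_def Z_def act_preserves B_e e_e)
  have \<xi>e: "\<xi> \<bullet> e \<noteq> 0" using height_nonzero \<xi> by simp
  have fe_lim: "(\<lambda>k. f k \<bullet> e) \<longlonglongrightarrow> \<xi> \<bullet> e" by (intro tendsto_intros f_lim)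
  have ev: "eventually (\<lambda>k. f k \<bullet> e \<noteq> 0) sequentially"
    by (rule tendsto_imp_eventually_ne[OF fe_lim \<xi>e])
  have "(\<lambda>k. B (f k) (f k) / B z z) \<longlonglongrightarrow> B \<xi> \<xi> / B z z"
    using z by (intro tendsto_intros tendsto_B f_lim) auto
  moreover have "B (f k) (f k) / B z z = (c k)\<^sup>2" for k
    using z by (simp add: f_def B_linear BX power2_eq_square)
  ultimately have "(\<lambda>k. (c k)\<^sup>2) \<longlonglongrightarrow> 0" using \<xi> by simp
  then have c0: "c \<longlonglongrightarrow> 0" by simp
  have "1 \<le> (Z k \<bullet> e)\<^sup>2" for k
    using B_ge_height[of "Z k"] \<kappa>_pos by (simp add: BZ)
  then have Z1: "1 \<le> \<bar>Z k \<bullet> e\<bar>" for k by (metis abs_le_square_iff abs_one one_power2)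
  define E where "E k = X k /\<^sub>R (X k \<bullet> e) - Z k /\<^sub>R (Z k \<bullet> e)" for k
  have E_bound: "(norm (E k))\<^sup>2 \<le> 2 * \<bar>B z e\<bar> * (\<bar>c k\<bar> / \<bar>f k \<bullet> e\<bar>) / \<mu>" if k: "f k \<bullet> e \<noteq> 0" for k
  proof -
    have ck: "c k \<noteq> 0" "X k \<bullet> e \<noteq> 0" using k by (auto simp: f_def)
    have "\<mu> * (norm (E k))\<^sup>2 \<le> 2 * \<bar>B z e\<bar> / (\<bar>X k \<bullet> e\<bar> * \<bar>Z k \<bullet> e\<bar>)"
      unfolding E_def using timelike_direction_dist[of "X k" "Z k"] z \<kappa>_pos by (simp add: BX BZ BXZ)
    also have "\<dots> \<le> 2 * \<bar>B z e\<bar> / (\<bar>X k \<bullet> e\<bar> * 1)"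
      using ck Z1[of k] by (intro divide_left_mono mult_left_mono) (auto intro!: mult_pos_pos)
    also have "\<dots> = 2 * \<bar>B z e\<bar> * (\<bar>c k\<bar> / \<bar>f k \<bullet> e\<bar>)"
      using ck by (simp add: f_def abs_mult)
    finally have "(norm (E k))\<^sup>2 * \<mu> \<le> 2 * \<bar>B z e\<bar> * (\<bar>c k\<bar> / \<bar>f k \<bullet> e\<bar>)"
      by (subst mult.commute)
    with \<mu>_pos show ?thesis by (rule mult_imp_le_div_pos)
  qed
  have "(\<lambda>k. 2 * \<bar>B z e\<bar> * (\<bar>c k\<bar> / \<bar>f k \<bullet> e\<bar>) / \<mu>) \<longlonglongrightarrow> 2 * \<bar>B z e\<bar> * (\<bar>0\<bar> / \<bar>\<xi> \<bullet> e\<bar>) / \<mu>"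
    using \<xi>e \<mu>_pos by (intro tendsto_intros c0 fe_lim) auto
  then have upper: "(\<lambda>k. 2 * \<bar>B z e\<bar> * (\<bar>c k\<bar> / \<bar>f k \<bullet> e\<bar>) / \<mu>) \<longlonglongrightarrow> 0" by simp
  have "(\<lambda>k. (norm (E k))\<^sup>2) \<longlonglongrightarrow> 0"
  proof (rule tendsto_sandwich)
    show "eventually (\<lambda>k. 0 \<le> (norm (E k))\<^sup>2) sequentially" by simp
    show "eventually (\<lambda>k. (norm (E k))\<^sup>2 \<le> 2 * \<bar>B z e\<bar> * (\<bar>c k\<bar> / \<bar>f k \<bullet> e\<bar>) / \<mu>) sequentially"
      using ev by eventually_elim (rule E_bound)
    show "(\<lambda>k. 0 :: real) \<longlonglongrightarrow> 0" by simp
    show "(\<lambda>k. 2 * \<bar>B z e\<bar> * (\<bar>c k\<bar> / \<bar>f k \<bullet> e\<bar>) / \<mu>) \<longlonglongrightarrow> 0" by (rule upper)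
  qed
  then have E0: "E \<longlonglongrightarrow> 0" by (simp add: tendsto_norm_zero_iff)
  have "(\<lambda>k. f k /\<^sub>R (f k \<bullet> e)) \<longlonglongrightarrow> \<xi> /\<^sub>R (\<xi> \<bullet> e)"
    by (intro tendsto_intros f_lim \<xi>e)
  moreover have "eventually (\<lambda>k. f k /\<^sub>R (f k \<bullet> e) = X k /\<^sub>R (X k \<bullet> e)) sequentially"
    using ev by eventually_elim (simp add: f_def)
  ultimately have "(\<lambda>k. X k /\<^sub>R (X k \<bullet> e)) \<longlonglongrightarrow> \<xi> /\<^sub>R (\<xi> \<bullet> e)"
    by (rule Lim_transform_eventually)
  from tendsto_diff[OF this E0] show ?thesis by (simp add: E_def Z_def)
qed

end


section \<open>Limit sets\<close>

lemma height_eq_inner: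
  assumes "neg_eigenvector B I \<in> root_span I"
  shows "height B I v = v \<bullet> neg_eigenvector B I"
  using inner_root_span[OF assms, of v] by (simp add: height_def)

lemma limit_set_sequence:
  assumes "\<xi> \<in> limit_set B I H"
  shows "\<exists>w. (\<forall>k::nat. w k \<in> H) \<and>
    (\<forall>k. normalized_action B I (w k) (neg_eigenvector B I) \<noteq> \<xi>) \<and>
    (\<lambda>k. normalized_action B I (w k) (neg_eigenvector B I)) \<longlonglongrightarrow> \<xi>"
proof -
  let ?f = "\<lambda>w. normalized_action B I w (neg_eigenvector B I)"
  have "\<xi> islimpt (?f ` H)"
    unfolding islimpt_def
  proof (intro allI impI)
    fix T assume T: "\<xi> \<in> T" "open T"
    then have "openin (top_of_set (height_one B I)) (height_one B I \<inter> T)" by blast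
    moreover have "\<xi> \<in> height_one B I"
      using assms by (simp add: limit_set_def in_derived_set_of)
    ultimately show "\<exists>y\<in>?f ` H. y \<in> T \<and> y \<noteq> \<xi>"
      using assms T(1) unfolding limit_set_def in_derived_set_of by blast
  qed
  then obtain f where f: "\<And>k::nat. f k \<in> ?f ` H - {\<xi>}" "f \<longlonglongrightarrow> \<xi>"
    unfolding islimpt_sequential by blast
  then have "\<forall>k. \<exists>w\<in>H. f k = ?f w" by blast
  then obtain w where w: "\<And>k. w k \<in> H" "\<And>k. f k = ?f (w k)" by metis
  have "f = (\<lambda>k. ?f (w k))" using w(2) by blast
  then show ?thesis using w(1) f by (intro exI[of _ w]) auto
qed

lemma in_limit_setI:
  assumes "\<xi> \<in> height_one B I" "\<And>k::nat. w k \<in> H"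
    and "\<And>k. normalized_action B I (w k) (neg_eigenvector B I) \<in> height_one B I - {\<xi>}"
    and "(\<lambda>k. normalized_action B I (w k) (neg_eigenvector B I)) \<longlonglongrightarrow> \<xi>"
  shows "\<xi> \<in> limit_set B I H"
  unfolding limit_set_def in_derived_set_of
proof (intro conjI allI impI)
  show "\<xi> \<in> topspace (top_of_set (height_one B I))" using assms(1) by simp
  fix T assume T: "\<xi> \<in> T \<and> openin (top_of_set (height_one B I)) T"
  then obtain U where U: "open U" "T = height_one B I \<inter> U" by (auto simp: openin_open)
  have "eventually (\<lambda>k. normalized_action B I (w k) (neg_eigenvector B I) \<in> U) sequentially"
    using assms(4) U T by (intro topological_tendstoD) auto
  then obtain k where "normalized_action B I (w k) (neg_eigenvector B I) \<in> U"
    by (auto simp: eventually_sequentially)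
  then show "\<exists>y\<noteq>\<xi>. y \<in> (\<lambda>w. normalized_action B I w (neg_eigenvector B I)) ` H \<and> y \<in> T"
    using assms(2,3)[of k] U(2) by blast
qed

lemma rescaling_embedding:
  fixes a b :: "'a::real_inner"
  assumes "\<And>x. x \<in> X \<Longrightarrow> x \<bullet> a = 1" "\<And>x. x \<in> X \<Longrightarrow> x \<bullet> b \<noteq> 0"
  shows "embedding_map (top_of_set X) euclidean (\<lambda>x. x /\<^sub>R (x \<bullet> b))"
proof -
  define f where "f = (\<lambda>x. x /\<^sub>R (x \<bullet> b))"
  define g where "g = (\<lambda>y. y /\<^sub>R (y \<bullet> a))"
  have gf: "g (f x) = x" if "x \<in> X" for x using assms that by (simp add: f_def g_def)
  have "continuous_on X f"
    unfolding f_def using assms(2) by (intro continuous_intros) auto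
  moreover have "continuous_on (f ` X) g"
    unfolding g_def using assms by (intro continuous_intros) (auto simp: f_def)
  ultimately have "homeomorphic_maps (top_of_set X) (top_of_set (f ` X)) f g"
    using gf by (auto simp: homeomorphic_maps_def)
  then show ?thesis
    unfolding embedding_map_def homeomorphic_map_maps f_def[symmetric] by auto
qed

theorem corollary1p2:
  fixes m :: "'n::finite \<Rightarrow> 'n \<Rightarrow> enat"
    and B :: "real ^ 'n \<Rightarrow> real ^ 'n \<Rightarrow> real"
    and S' :: "'n set"
  assumes "coxeter_matrix m"
    and "associated_form m B"
    and "signature B UNIV = (CARD('n) - 1, 1)"
    and "irreducible_form B UNIV"
    and "signature B S' = (card S' - 1, 1)"
    and "irreducible_form B S'"
    and "cocompact_action B S'"
  shows "\<exists>\<iota>. embedding_map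
            (top_of_set (limit_set B S' (special_subgroup m S')))
            (top_of_set (limit_set B UNIV (carrier (coxeter_group m)))) \<iota> \<and>
          (\<forall>w \<xi>. (\<forall>k::nat. w k \<in> special_subgroup m S') \<longrightarrow>
             \<xi> \<in> limit_set B S' (special_subgroup m S') \<longrightarrow>
             (\<lambda>k. normalized_action B S' (w k) (neg_eigenvector B S')) \<longlonglongrightarrow> \<xi> \<longrightarrow>
             (\<lambda>k. normalized_action B UNIV (w k) (neg_eigenvector B UNIV)) \<longlonglongrightarrow> \<iota> \<xi>)"
proof -
  interpret coxeter_form m B using assms(1,2) by unfold_locales
  let ?\<Lambda>' = "limit_set B S' (special_subgroup m S')"
  let ?\<Lambda> = "limit_set B UNIV (carrier (coxeter_group m))"
  define e where "e = neg_eigenvector B UNIV"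
  define e' where "e' = neg_eigenvector B S'"

  obtain l where l: "l < 0" "e \<in> eigenspace B UNIV l" "norm e = 1" "\<And>i. 0 < e $ i"
    unfolding e_def using perron_frobenius[OF B_simple_nonpos assms(4)] assms(3) by auto
  obtain \<mu> where \<mu>: "0 < \<mu>" "\<And>u. u \<bullet> e = 0 \<Longrightarrow> \<mu> * (u \<bullet> u) \<le> B u u"
    by (rule positive_on_complement[OF l(2,3,1) assms(3)]) blast
  interpret lorentz_coxeter_form m B e "- l" \<mu>
    by unfold_locales (use l \<mu> in \<open>auto simp: eigenspace_iff root_span_UNIV\<close>)
  obtain l' where l': "l' < 0" "e' \<in> eigenspace B S' l'" "norm e' = 1"
    unfolding e'_def using perron_frobenius[OF B_simple_nonpos assms(6)] assms(5) by auto
  have e'_span: "e' \<in> root_span S'" using l'(2) by (simp add: eigenspace_iff)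
  have Be': "B e' e' < 0" using l' e'_span by (simp add: eigenspace_iff dot_square_norm)

  have act_e: "normalized_action B UNIV (word_class m u) e = act u e /\<^sub>R (act u e \<bullet> e)" for u
    using height_eq_inner[of B UNIV]
    by (simp add: normalized_action_def normalize_vec_def group_action_word_class e_def root_span_UNIV)
  have act_e': "normalized_action B S' (word_class m u) e' = act u e' /\<^sub>R (act u e' \<bullet> e')" for u
    using height_eq_inner[of B S'] e'_span
    by (simp add: normalized_action_def normalize_vec_def group_action_word_class e'_def)
  have words: "\<exists>u. \<forall>k. w k = word_class m (u k)"
    if "\<forall>k::nat. w k \<in> special_subgroup m S'" for w
  proof -
    have "\<forall>k. \<exists>u. w k = word_class m u"
      using that special_subgroup_subset[OF assms(1), of S'] by (fastforce simp: coxeter_group_def)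
    then show ?thesis by metis
  qed
  have sub: "word_class m u \<in> carrier (coxeter_group m)" for u
    by (simp add: coxeter_group_def)
  have height_one_UNIV: "v \<in> height_one B UNIV \<longleftrightarrow> v \<bullet> e = 1" for v
    using height_eq_inner[of B UNIV] by (simp add: height_one_def root_span_UNIV e_def)

  have \<Lambda>'_height: "\<xi> \<bullet> e' = 1" if "\<xi> \<in> ?\<Lambda>'" for \<xi>
    using that height_eq_inner[of B S'] e'_span
    by (simp add: limit_set_def in_derived_set_of height_one_def e'_def)
  have \<Lambda>'_null: "B \<xi> \<xi> = 0" if \<xi>: "\<xi> \<in> ?\<Lambda>'" for \<xi>
  proof -
    obtain w where w: "\<forall>k. w k \<in> special_subgroup m S'" "\<forall>k. normalized_action B S' (w k) e' \<noteq> \<xi>"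
      "(\<lambda>k. normalized_action B S' (w k) e') \<longlonglongrightarrow> \<xi>"
      using limit_set_sequence[OF \<xi>, folded e'_def] by (elim exE conjE)
    obtain u where u: "\<And>k. w k = word_class m (u k)" using words[OF w(1)] by blast
    show ?thesis
      using w(3) spec[OF w(2)] unfolding u act_e'
      by (intro orbit_accumulates_on_cone[OF Be', where c = "\<lambda>v. inverse (v \<bullet> e')" and u = u])
  qed
  have \<Lambda>'_nonzero: "\<xi> \<noteq> 0" "\<xi> \<bullet> e \<noteq> 0" if "\<xi> \<in> ?\<Lambda>'" for \<xi>
  proof -
    show "\<xi> \<noteq> 0" using \<Lambda>'_height[OF that] by auto
    then show "\<xi> \<bullet> e \<noteq> 0" using height_nonzero \<Lambda>'_null[OF that] by simp
  qed

  define \<iota> where "\<iota> \<xi> = \<xi> /\<^sub>R (\<xi> \<bullet> e)" for \<xi>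
  have conv: "(\<lambda>k. normalized_action B UNIV (w k) e) \<longlonglongrightarrow> \<iota> \<xi>"
    if w: "\<forall>k::nat. w k \<in> special_subgroup m S'" and \<xi>: "\<xi> \<in> ?\<Lambda>'"
      and lim: "(\<lambda>k. normalized_action B S' (w k) e') \<longlonglongrightarrow> \<xi>" for w \<xi>
  proof -
    obtain u where u: "\<And>k. w k = word_class m (u k)" using words[OF w] by blast
    show ?thesis
      using lim unfolding u act_e act_e' \<iota>_def
      by (rule orbit_directions_converge[OF Be' _ \<Lambda>'_nonzero(1)[OF \<xi>] \<Lambda>'_null[OF \<xi>]])
  qed

  have "\<iota> \<xi> \<in> ?\<Lambda>" if \<xi>: "\<xi> \<in> ?\<Lambda>'" for \<xi>
  proof -
    obtain w where w: "\<forall>k. w k \<in> special_subgroup m S'" "\<forall>k. normalized_action B S' (w k) e' \<noteq> \<xi>"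
      "(\<lambda>k. normalized_action B S' (w k) e') \<longlonglongrightarrow> \<xi>"
      using limit_set_sequence[OF \<xi>, folded e'_def] by (elim exE conjE)
    obtain u where u: "\<And>k. w k = word_class m (u k)" using words[OF w(1)] by blast
    have null: "B (\<iota> \<xi>) (\<iota> \<xi>) = 0"
      using \<Lambda>'_null[OF \<xi>] by (simp add: \<iota>_def B_linear)
    have timelike: "B (act v e) (act v e) < 0" for v
      using l(1) by (simp add: act_preserves B_e e_e)
    have "act v e \<bullet> e \<noteq> 0" for v
    proof (rule height_nonzero)
      show "B (act v e) (act v e) \<le> 0" using timelike[of v] by simp
      show "act v e \<noteq> 0" using timelike[of v] by (auto simp: B_linear)
    qed
    then have height: "normalized_action B UNIV (w k) e \<bullet> e = 1"
      and nonnull: "B (normalized_action B UNIV (w k) e) (normalized_action B UNIV (w k) e) \<noteq> 0" for k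
      using timelike[of "u k"] by (simp_all add: u act_e B_linear)
    have "normalized_action B UNIV (w k) e \<noteq> \<iota> \<xi>" for k
      using nonnull[of k] null by metis
    then have "normalized_action B UNIV (w k) e \<in> height_one B UNIV - {\<iota> \<xi>}" for k
      using height[of k] by (simp add: height_one_UNIV)
    moreover have "\<iota> \<xi> \<in> height_one B UNIV"
      using \<Lambda>'_nonzero(2)[OF \<xi>] by (simp add: height_one_UNIV \<iota>_def)
    ultimately show ?thesis
      using conv[OF w(1) \<xi> w(3)] u sub unfolding e_def by (intro in_limit_setI[where w = w]) auto
  qed
  then have "embedding_map (top_of_set ?\<Lambda>') (top_of_set ?\<Lambda>) \<iota>"
    using rescaling_embedding[of ?\<Lambda>' e' e] \<Lambda>'_height \<Lambda>'_nonzero(2)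
    by (simp add: embedding_map_in_subtopology \<iota>_def[abs_def] image_subset_iff)
  then show ?thesis
    using conv unfolding e_def e'_def by (intro exI[of _ \<iota>] conjI allI impI) auto
qed

end
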